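(* Given $s\ge1$, $C>0$ and $c\ge1$, there exists $L=L(c,C,s)>1$ with the following property. If $d$ is a metric on $[0,1]$ inducing the standard topology such that $\Gamma=([0,1],d)$ is $c$-bounded turning and $(C,s)$-homogeneous, then $\Gamma$ is $L$-bi-Lipschitz embeddable in $\mathbb{R}^{\lfloor s\rfloor+1}$.
   Context: A metric space is $c$-bounded turning if each pair of points $x,y$ lies in a continuum (compact connected set) of diameter at most $c\,d(x,y)$. A metric space is $(C,s)$-homogeneous if for every $\epsilon\in(0,1)$ every subset of diameter $D$ can be covered by at most $C\epsilon^{-s}$ sets of diameter at most $\epsilon D$. An $L$-bi-Lipschitz embedding is a map $f$ with $L^{-1}d(x,y)\le|f(x)-f(y)|\le L\,d(x,y)$ for all $x,y$. *)

theory Defs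
  imports "HOL-Analysis.Analysis"
begin

context Metric_space
begin

(* Real-valued, as the library's diameter for type-class metric spaces; it is the
   actual diameter only for sets satisfying mbounded. *)
definition mdiameter :: "'a set \<Rightarrow> real"
  where "mdiameter S = (if S = {} then 0 else SUP (x, y)\<in>S \<times> S. d x y)"

definition bounded_turning :: "real \<Rightarrow> bool"
  where "bounded_turning c \<longleftrightarrow>
    (\<forall>x\<in>M. \<forall>y\<in>M. \<exists>K. compactin mtopology K \<and> connectedin mtopology K \<and>
       x \<in> K \<and> y \<in> K \<and> mdiameter K \<le> c * d x y)"

(* Only sets of finite diameter are tested, since mdiameter is meaningless otherwise. *)
definition homogeneous :: "real \<Rightarrow> real \<Rightarrow> bool"
  where "homogeneous C s \<longleftrightarrow>
    (\<forall>\<epsilon>\<in>{0<..<1}. \<forall>A. mbounded A \<longrightarrow>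
       (\<exists>\<U>. finite \<U> \<and> real (card \<U>) \<le> C * \<epsilon> powr (- s) \<and> A \<subseteq> \<Union>\<U> \<and>
          (\<forall>U\<in>\<U>. mbounded U \<and> mdiameter U \<le> \<epsilon> * mdiameter A)))"

definition bilipschitz_embedding :: "real \<Rightarrow> ('a \<Rightarrow> 'b::real_normed_vector) \<Rightarrow> bool"
  where "bilipschitz_embedding L f \<longleftrightarrow>
    (\<forall>x\<in>M. \<forall>y\<in>M. inverse L * d x y \<le> norm (f x - f y) \<and> norm (f x - f y) \<le> L * d x y)"

end

end

theory Submission
  imports Defs
begin

text \<open>Bounded turning makes the diameter of the subarc between two points comparable to their distance.
  Fix a large m and let \<open>r\<^sub>k = D / (4m)^k\<close>, where D is the diameter of the arc. The arc is cut
  successively into subarcs of diameter between \<open>r\<^sub>k\<close> and \<open>3r\<^sub>k\<close>, and the cutting points of generation k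
  are mapped injectively to \<open>\<int>\<^sup>n\<close>, consecutive ones to neighbours. In passing to the next generation the
  lattice is scaled by 4m, each edge becomes an interval of length 4m, and this interval is replaced by a
  self-avoiding lattice path with one edge for each new subarc. By homogeneity there are
  \<open>O(m^s)\<close> of them, while a path that stays near the edge can have any even length between 4m and
  \<open>2m^n\<close>; as \<open>s < n\<close>, all required lengths occur. The paths replacing different edges stay in disjoint
  double cones, so the new map is again injective. After rescaling the maps converge, and
  subarcs of generation k without common endpoint have images at distance comparable to \<open>r\<^sub>k\<close>.\<close>

section \<open>Self-avoiding grid paths\<close>

definition grid_adj :: "('n \<Rightarrow> int) \<Rightarrow> ('n \<Rightarrow> int) \<Rightarrow> bool"
  where "grid_adj p q \<longleftrightarrow> (\<exists>i. q = p(i := p i + 1) \<or> p = q(i := q i + 1))"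

lemma grid_adj_commute: "grid_adj p q \<longleftrightarrow> grid_adj q p"
  unfolding grid_adj_def by (simp add: ex_disj_distrib disj_commute)

lemma grid_adj_step: "grid_adj (x(i := t)) (x(i := t + 1))"
  unfolding grid_adj_def by (rule exI[of _ i]) simp

lemma grid_adj_cases:
  assumes "grid_adj p q"
  obtains i where "q = p(i := p i + 1)" | i where "p = q(i := q i + 1)"
  using assms unfolding grid_adj_def by metis

lemma grid_adjI: "grid_adj p (p(i := p i + 1))"
  unfolding grid_adj_def by metis

text \<open>Agreement in coordinate \<open>i\<close> forces the unit step to be in another
  direction, which the update leaves alone.\<close>

lemma grid_adj_upd:
  assumes "grid_adj p q" "p i = q i"
  shows "grid_adj (p(i := t)) (q(i := t))"
proof -
  have *: "grid_adj (p(i := t)) (q(i := t))" if "q = p(j := p j + 1)" "p i = q i"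
    for p q :: "'a \<Rightarrow> int" and j
  proof -
    have "j \<noteq> i" using that by auto
    then have "q(i := t) = (p(i := t))(j := (p(i := t)) j + 1)"
      unfolding that(1) by (simp add: fun_upd_twist)
    then show ?thesis by (metis grid_adjI)
  qed
  from assms(1) show ?thesis
    by (cases rule: grid_adj_cases) (use * assms(2) grid_adj_commute in metis)+
qed

lemma grid_adj_translate:
  assumes "grid_adj p q"
  shows "grid_adj (\<lambda>j. u j + p j) (\<lambda>j. u j + q j)"
proof -
  have *: "grid_adj (\<lambda>j. u j + p j) (\<lambda>j. u j + q j)" if "q = p(j := p j + 1)"
    for p q :: "'a \<Rightarrow> int" and j
  proof -
    have "(\<lambda>j. u j + q j) = (\<lambda>j. u j + p j)(j := (u j + p j) + 1)"
      unfolding that by (rule ext) simp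
    then show ?thesis by (metis (no_types, lifting) grid_adjI)
  qed
  from assms show ?thesis
    by (cases rule: grid_adj_cases) (use * grid_adj_commute in metis)+
qed

text \<open>\<open>N\<close> counts edges rather than vertices, because each edge will carry one
  subarc. The set \<open>V\<close> confines the path, so that disjointness of paths can be read off
  from their regions.\<close>

definition grid_path ::
  "('n \<Rightarrow> int) set \<Rightarrow> ('n \<Rightarrow> int) \<Rightarrow> ('n \<Rightarrow> int) \<Rightarrow> nat \<Rightarrow> bool"
  where "grid_path V p q N \<longleftrightarrow>
    (\<exists>z. z 0 = p \<and> z N = q \<and> inj_on z {..N} \<and> z ` {..N} \<subseteq> V \<and>
      (\<forall>k<N. grid_adj (z k) (z (Suc k))))"

lemma grid_path_mono: "grid_path V p q N \<Longrightarrow> V \<subseteq> W \<Longrightarrow> grid_path W p q N"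
  unfolding grid_path_def by blast

lemma grid_path_refl: "p \<in> V \<Longrightarrow> grid_path V p p 0"
  unfolding grid_path_def by (rule exI[of _ "\<lambda>_. p"]) auto

text \<open>Disjointness of the two regions keeps the concatenation self-avoiding; the connecting
  edge accounts for the summand 1.\<close>

lemma grid_path_join:
  assumes "grid_path V p q N" "grid_adj q p'" "grid_path W p' q' N'" "V \<inter> W = {}"
  shows "grid_path (V \<union> W) p q' (N + N' + 1)"
proof -
  obtain z where z: "z 0 = p" "z N = q" "inj_on z {..N}" "z ` {..N} \<subseteq> V"
    "\<forall>k<N. grid_adj (z k) (z (Suc k))"
    using assms(1) grid_path_def by blast
  obtain y where y: "y 0 = p'" "y N' = q'" "inj_on y {..N'}" "y ` {..N'} \<subseteq> W"
    "\<forall>k<N'. grid_adj (y k) (y (Suc k))"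
    using assms(3) grid_path_def by blast
  define x where "x k = (if k \<le> N then z k else y (k - N - 1))" for k
  have xV: "x k \<in> V" if "k \<le> N" for k
    using z(4) that by (auto simp: x_def)
  have xW: "x k \<in> W" if "\<not> k \<le> N" "k \<le> N + N' + 1" for k
  proof -
    have "k - N - 1 \<le> N'" using that by linarith
    then show ?thesis using y(4) that(1) by (auto simp: x_def)
  qed
  have inj: "inj_on x {..N + N' + 1}"
  proof (rule inj_onI)
    fix j k assume jk: "j \<in> {..N + N' + 1}" "k \<in> {..N + N' + 1}" and eq: "x j = x k"
    have "j \<le> N \<longleftrightarrow> k \<le> N"
      using xV[of j] xV[of k] xW[of j] xW[of k] jk eq assms(4) by auto
    then consider "j \<le> N" "k \<le> N" | "\<not> j \<le> N" "\<not> k \<le> N" by blast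
    then show "j = k"
    proof cases
      case 1
      then show ?thesis using eq inj_onD[OF z(3), of j k] by (simp add: x_def)
    next
      case 2
      then have "y (j - N - 1) = y (k - N - 1)" using eq by (simp add: x_def)
      moreover have "j - N - 1 \<le> N'" "k - N - 1 \<le> N'" using jk 2 by auto
      ultimately have "j - N - 1 = k - N - 1" using inj_onD[OF y(3)] by blast
      then show ?thesis using 2 by linarith
    qed
  qed
  have sub: "x ` {..N + N' + 1} \<subseteq> V \<union> W"
    using xV xW by blast
  have adj: "grid_adj (x k) (x (Suc k))" if "k < N + N' + 1" for k
  proof -
    consider "k < N" | "k = N" | "k > N" by linarith
    then show ?thesis
    proof cases
      case 1
      then show ?thesis using z(5) by (simp add: x_def)
    next
      case 2
      then show ?thesis using z(2) y(1) assms(2) by (simp add: x_def)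
    next
      case 3
      then have *: "Suc k - N - 1 = Suc (k - N - 1)" "k - N - 1 < N'" using that by linarith+
      have "x k = y (k - N - 1)" "x (Suc k) = y (Suc k - N - 1)" using 3 by (simp_all add: x_def)
      then show ?thesis using y(5) * by metis
    qed
  qed
  show ?thesis
    unfolding grid_path_def
  proof (intro exI[of _ x] conjI allI impI)
    show "x 0 = p" "x (N + N' + 1) = q'" using z(1) y(2) by (simp_all add: x_def)
  qed (fact inj sub adj)+
qed

lemma grid_path_rev:
  assumes "grid_path V p q N"
  shows "grid_path V q p N"
proof -
  obtain z where z: "z 0 = p" "z N = q" "inj_on z {..N}" "z ` {..N} \<subseteq> V"
    "\<forall>k<N. grid_adj (z k) (z (Suc k))"
    using assms grid_path_def by blast
  have "inj_on (\<lambda>k. z (N - k)) {..N}"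
  proof (rule inj_onI)
    fix j k assume jk: "j \<in> {..N}" "k \<in> {..N}" and "z (N - j) = z (N - k)"
    then have "N - j = N - k" using inj_onD[OF z(3)] by simp
    then show "j = k" using jk by simp
  qed
  moreover have "grid_adj (z (N - k)) (z (N - Suc k))" if "k < N" for k
  proof -
    have "N - k = Suc (N - Suc k)" using that by linarith
    moreover have "N - Suc k < N" using that by linarith
    ultimately show ?thesis using z(5) grid_adj_commute by metis
  qed
  ultimately show ?thesis
    unfolding grid_path_def
    by (intro exI[of _ "\<lambda>k. z (N - k)"]) (use z in \<open>auto simp: image_subset_iff\<close>)
qed

lemma grid_path_prefix:
  assumes "grid_path V p q N" "k \<le> N"
  shows "\<exists>q'. grid_path V p q' k"
proof -
  obtain z where z: "z 0 = p" "inj_on z {..N}" "z ` {..N} \<subseteq> V"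
    "\<forall>k<N. grid_adj (z k) (z (Suc k))"
    using assms grid_path_def by blast
  have "inj_on z {..k}" using z(2) assms(2) by (auto intro: inj_on_subset)
  then show ?thesis
    unfolding grid_path_def
    by (intro exI[of _ "z k"] exI[of _ z]) (use z assms(2) in auto)
qed

lemma grid_path_map:
  assumes "grid_path V p q N" "inj_on h V"
    and "\<And>x y. x \<in> V \<Longrightarrow> y \<in> V \<Longrightarrow> grid_adj x y \<Longrightarrow> grid_adj (h x) (h y)"
  shows "grid_path (h ` V) (h p) (h q) N"
proof -
  obtain z where z: "z 0 = p" "z N = q" "inj_on z {..N}" "z ` {..N} \<subseteq> V"
    "\<forall>k<N. grid_adj (z k) (z (Suc k))"
    using assms(1) grid_path_def by blast
  have "inj_on (h \<circ> z) {..N}"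
    using z(3) assms(2) z(4) by (meson comp_inj_on inj_on_subset)
  moreover have "grid_adj (h (z k)) (h (z (Suc k)))" if "k < N" for k
    using that z(4,5) assms(3)[of "z k" "z (Suc k)"] by (auto simp: image_subset_iff)
  ultimately show ?thesis
    unfolding grid_path_def
    by (intro exI[of _ "h \<circ> z"]) (use z in auto)
qed

section \<open>Hamiltonian paths of boxes\<close>

text \<open>The box is a cube of side \<open>m\<close> spanned by the directions in
  \<open>J\<close>. Fixing the other coordinates at 0 lets cubes of all dimensions live in one
  lattice, which suits induction on \<open>J\<close>.\<close>

definition grid_box :: "'n set \<Rightarrow> nat \<Rightarrow> ('n \<Rightarrow> int) set"
  where "grid_box J m = {x. \<forall>j. if j \<in> J then 0 \<le> x j \<and> x j < int m else x j = 0}"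

definition grid_layer :: "'n set \<Rightarrow> nat \<Rightarrow> 'n \<Rightarrow> int \<Rightarrow> ('n \<Rightarrow> int) set"
  where "grid_layer J m i t = (\<lambda>x. x(i := t)) ` grid_box J m"

lemma grid_layer_coord: "x \<in> grid_layer J m i t \<Longrightarrow> x i = t"
  by (auto simp: grid_layer_def)

text \<open>Points of the box have \<open>i\<close>-coordinate 0, so overwriting that coordinate by
  \<open>t\<close> is a translation in direction \<open>i\<close>.\<close>

lemma grid_path_lift:
  assumes "grid_path (grid_box J m) p q N" "i \<notin> J"
  shows "grid_path (grid_layer J m i t) (p(i := t)) (q(i := t)) N"
  unfolding grid_layer_def
proof (rule grid_path_map[OF assms(1)])
  have z: "x i = 0" if "x \<in> grid_box J m" for x
    using that assms(2) by (auto simp: grid_box_def split: if_splits)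
  show "inj_on (\<lambda>x. x(i := t)) (grid_box J m)"
  proof (rule inj_onI)
    fix x y assume "x \<in> grid_box J m" "y \<in> grid_box J m" "x(i := t) = y(i := t)"
    then show "x = y" using z[of x] z[of y] by (metis fun_upd_triv fun_upd_upd)
  qed
  show "grid_adj (x(i := t)) (y(i := t))"
    if "x \<in> grid_box J m" "y \<in> grid_box J m" "grid_adj x y" for x y
    using that z[of x] z[of y] by (auto intro: grid_adj_upd)
qed

text \<open>Induction on the dimension: the layers of the larger box are traversed one after
  another, alternately along the Hamiltonian path of the smaller box and along its reverse.\<close>

lemma hamiltonian_grid_path:
  assumes "finite J" "m > 0"
  shows "\<exists>q. grid_path (grid_box J m) (\<lambda>_. 0) q (m ^ card J - 1)"
  using assms(1)
proof (induction J)
  case empty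
  show ?case by (auto simp: grid_box_def intro!: exI[of _ "\<lambda>_. 0"] grid_path_refl)
next
  case (insert i J)
  let ?K = "m ^ card J"
  have K: "?K > 0" using assms(2) by simp
  obtain q where q: "grid_path (grid_box J m) (\<lambda>_. 0) q (?K - 1)"
    using insert by blast
  \<comment> \<open>After the layers 0 to \<open>h\<close> the path ends above \<open>q\<close> or
    above the origin according to the parity of \<open>h\<close>. It has visited
    \<open>Suc h * ?K\<close> vertices, hence uses one edge fewer.\<close>
  have *: "grid_path (\<Union>t\<in>{0..int h}. grid_layer J m i t) (\<lambda>_. 0)
      ((if even h then q else (\<lambda>_. 0))(i := int h)) (Suc h * ?K - 1)" for h
  proof (induction h)
    case 0
    have "(\<lambda>_. 0)(i := 0) = (\<lambda>_. 0::int)" by auto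
    then show ?case using grid_path_lift[OF q insert(2), of 0] by (simp only: of_nat_0 even_zero if_True atLeastAtMost_singleton UN_insert UN_empty
        Un_empty_right mult_Suc mult_0 add_0_right)
  next
    case (Suc h)
    have disj: "(\<Union>t\<in>{0..int h}. grid_layer J m i t) \<inter> grid_layer J m i (int (Suc h)) = {}"
      by (auto dest!: grid_layer_coord)
    have path: "grid_path (grid_layer J m i (int (Suc h)))
      ((if even h then q else (\<lambda>_. 0))(i := int (Suc h)))
      ((if even (Suc h) then q else (\<lambda>_. 0))(i := int (Suc h))) (?K - 1)"
      using grid_path_lift[OF q insert(2), of "int (Suc h)"]
        grid_path_lift[OF grid_path_rev[OF q] insert(2), of "int (Suc h)"] by auto
    have adj: "grid_adj ((if even h then q else (\<lambda>_. 0))(i := int h))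
       ((if even h then q else (\<lambda>_. 0))(i := int (Suc h)))"
      using grid_adj_step[of "if even h then q else (\<lambda>_. 0)" i "int h"]
      by (simp add: add.commute)
    have len: "(Suc h * ?K - 1) + (?K - 1) + 1 = Suc (Suc h) * ?K - 1"
      using gr0_implies_Suc[OF K] by auto
    have un: "(\<Union>t\<in>{0..int h}. grid_layer J m i t) \<union> grid_layer J m i (int (Suc h)) = (\<Union>t\<in>{0..int (Suc h)}. grid_layer J m i t)"
    proof -
      have "{0..int (Suc h)} = insert (int (Suc h)) {0..int h}" by auto
      then show ?thesis by simp blast
    qed
    show ?case
      using grid_path_join[OF Suc adj path disj] unfolding len un .
  qed
  have "(\<Union>t\<in>{0..int (m - 1)}. grid_layer J m i t) \<subseteq> grid_box (insert i J) m"
  proof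
    fix y assume "y \<in> (\<Union>t\<in>{0..int (m - 1)}. grid_layer J m i t)"
    then obtain t x where t: "0 \<le> t" "t \<le> int (m - 1)" and x: "x \<in> grid_box J m"
      and y: "y = x(i := t)" by (auto simp: grid_layer_def)
    have "t < int m" using t assms(2) by linarith
    then show "y \<in> grid_box (insert i J) m"
      using t x unfolding y grid_box_def by simp
  qed
  from grid_path_mono[OF *[of "m - 1"] this] show ?case
    using assms(2) insert by auto
qed

section \<open>Lattice paths of prescribed length along an axis\<close>

definition axis_point :: "'n \<Rightarrow> int \<Rightarrow> 'n \<Rightarrow> int"
  where "axis_point i t = (\<lambda>_. 0)(i := t)"

lemma axis_point_step: "grid_adj (axis_point i t) (axis_point i (t + 1))"
  unfolding axis_point_def by (rule grid_adj_step)

lemma axis_path: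
  "grid_path (axis_point i ` {a..a + int k}) (axis_point i a) (axis_point i (a + int k)) k"
  unfolding grid_path_def
proof (intro exI[of _ "\<lambda>l. axis_point i (a + int l)"] conjI allI impI)
  show "inj_on (\<lambda>l. axis_point i (a + int l)) {..k}"
    by (auto simp: inj_on_def fun_eq_iff axis_point_def split: if_splits)
  show "grid_adj (axis_point i (a + int l)) (axis_point i (a + int (Suc l)))" for l
    using axis_point_step[of i "a + int l"] by (simp add: add_ac)
qed auto

(* The detour leaves the axis in the layer t, runs along a prefix of a Hamiltonian path of the box,
   and returns along the same prefix in the layer t + 1. *)
lemma detour_path:
  assumes "finite J" "i \<notin> J" "m > 0" "l \<le> m ^ card J - 1"
  shows "grid_path ((\<Union>t'\<in>{t..t + 1}. grid_layer J m i t'))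
    (axis_point i t) (axis_point i (t + 1)) (2 * l + 1)"
proof -
  obtain q where "grid_path (grid_box J m) (\<lambda>_. 0) q l"
    using hamiltonian_grid_path[OF assms(1,3)] grid_path_prefix assms(4) by blast
  note p = grid_path_lift[OF this assms(2)]
  have "grid_layer J m i t \<inter> grid_layer J m i (t + 1) = {}"
    by (auto dest!: grid_layer_coord)
  from grid_path_join[OF p[of t, folded axis_point_def] grid_adj_step grid_path_rev[OF p] this]
  have "grid_path (grid_layer J m i t \<union> grid_layer J m i (t + 1))
    (axis_point i t) (axis_point i (t + 1)) (2 * l + 1)"
    by (simp add: mult_2 flip: axis_point_def)
  then show ?thesis by (rule grid_path_mono) force
qed

text \<open>The straight path crosses \<open>k + 1\<close> pairs of layers. Each pair can host one
  detour absorbing between 0 and \<open>m ^ card J - 1\<close> units of the surplus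
  \<open>e\<close>, and one unit of surplus costs two edges, one in each layer of the pair.\<close>

lemma detours_path:
  assumes "finite J" "i \<notin> J" "m > 0" "e \<le> Suc k * (m ^ card J - 1)"
  shows "grid_path ((\<Union>t\<in>{a..a + 2 * int k + 1}. grid_layer J m i t))
    (axis_point i a) (axis_point i (a + 2 * int k + 1)) (2 * k + 1 + 2 * e)"
  using assms(4)
proof (induction k arbitrary: e)
  case 0
  then show ?case using detour_path[OF assms(1-3), of e a] by (simp add: mult.commute)
next
  case (Suc k)
  let ?c = "m ^ card J - 1"
  \<comment> \<open>The last pair of layers absorbs as much as it can; what remains fits into the
    earlier pairs.\<close>
  define l where "l = min e ?c"
  have "e - l \<le> Suc k * ?c" using Suc.prems by (auto simp: l_def)
  note p = Suc.IH[OF this]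
  have "l \<le> ?c" by (simp add: l_def)
  note d = detour_path[OF assms(1-3) this, of "a + 2 * int k + 1 + 1"]
  have disj: "(\<Union>t\<in>{a..a + 2 * int k + 1}. grid_layer J m i t) \<inter>
      (\<Union>t\<in>{a + 2 * int k + 1 + 1..a + 2 * int k + 1 + 1 + 1}. grid_layer J m i t) = {}"
    by (auto dest!: grid_layer_coord)
  have len: "2 * k + 1 + 2 * (e - l) + (2 * l + 1) + 1 = 2 * Suc k + 1 + 2 * e"
    by (auto simp: l_def)
  have un: "(\<Union>t\<in>{a..a + 2 * int k + 1}. grid_layer J m i t) \<union>
      (\<Union>t\<in>{a + 2 * int k + 1 + 1..a + 2 * int k + 1 + 1 + 1}. grid_layer J m i t)
    \<subseteq> (\<Union>t\<in>{a..a + 2 * int (Suc k) + 1}. grid_layer J m i t)"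
    by (rule Un_least; rule UN_mono) auto
  have "a + 2 * int k + 1 + 1 + 1 = a + 2 * int (Suc k) + 1" by simp
  with grid_path_mono[OF grid_path_join[OF p axis_point_step d disj, unfolded len] un]
  show ?case by metis
qed

section \<open>Cells of grid edges\<close>

text \<open>The unit edge from p in direction i, scaled by 4m, is surrounded by an open double cone of slope 1
  with the scaled endpoints as apices, truncated at distance m from the axis. Cones of different edges
  are disjoint.\<close>

definition edge_region :: "nat \<Rightarrow> ('n \<Rightarrow> int) \<Rightarrow> 'n \<Rightarrow> ('n \<Rightarrow> int) set"
  where "edge_region m p i =
    {x. 0 < x i - 4 * int m * p i \<and> x i - 4 * int m * p i < 4 * int m \<and>
      (\<forall>j. j \<noteq> i \<longrightarrow> \<bar>x j - 4 * int m * p j\<bar> < int m \<and>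
         \<bar>x j - 4 * int m * p j\<bar> < x i - 4 * int m * p i \<and>
         \<bar>x j - 4 * int m * p j\<bar> < 4 * int m - (x i - 4 * int m * p i))}"

definition grid_scale :: "nat \<Rightarrow> ('n \<Rightarrow> int) \<Rightarrow> 'n \<Rightarrow> int"
  where "grid_scale m p = (\<lambda>j. 4 * int m * p j)"

text \<open>A region is described by the lower endpoint and the direction of its edge. Quantifying
  over both makes the cell independent of the order of \<open>p\<close> and \<open>q\<close>. The
  two apices, which the open cone omits, are added.\<close>

definition edge_cell :: "nat \<Rightarrow> ('n \<Rightarrow> int) \<Rightarrow> ('n \<Rightarrow> int) \<Rightarrow> ('n \<Rightarrow> int) set"
  where "edge_cell m p q = {grid_scale m p, grid_scale m q} \<union>
    {x. \<exists>u i. {p, q} = {u, u(i := u i + 1)} \<and> x \<in> edge_region m u i}"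

lemma edge_cell_commute: "edge_cell m p q = edge_cell m q p"
  unfolding edge_cell_def by (simp add: insert_commute)

text \<open>The path is straight up to height \<open>m - 1\<close> and again from
  \<open>3 * m\<close> on, where the cone narrows to its apices. Detours are confined to the heights
  from \<open>m\<close> to \<open>3 * m - 1\<close>, where the cone has room for the whole cube of
  side \<open>m\<close>.\<close>

lemma axis_grid_path:
  fixes i :: "'n::finite"
  assumes "m > 0" "even N" "4 * m \<le> N" "N \<le> 2 * m ^ CARD('n)"
  shows "grid_path ({axis_point i 0, axis_point i (4 * int m)} \<union> edge_region m (\<lambda>_. 0) i)
    (axis_point i 0) (axis_point i (4 * int m)) N"
    (is "grid_path ?V _ _ _")
proof -
  let ?J = "UNIV - {i}"
  \<comment> \<open>The surplus over the straight path, counted in pairs of edges; evenness of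
    \<open>N\<close> makes the division exact. The \<open>m\<close> pairs of layers can absorb up to
    \<open>m * (m ^ card ?J - 1)\<close>.\<close>
  define e where "e = (N - 4 * m) div 2"
  have N: "N = 4 * m + 2 * e" using assms(2,3) by (auto simp: e_def)
  have pow: "m * m ^ card ?J = m ^ CARD('n)"
    by (metis Suc_pred card_Diff_singleton finite_UNIV_card_ge_0 finite_class.finite_UNIV UNIV_I power_Suc One_nat_def)
  have "e \<le> m * m ^ card ?J - m" unfolding pow using N assms(4) by linarith
  then have e: "e \<le> Suc (m - 1) * (m ^ card ?J - 1)"
    using assms(1) by (simp add: diff_mult_distrib2)
  note p1 = axis_path[of i 0 "m - 1"]
  note p2 = detours_path[OF _ _ assms(1) e, of i "int m"]
  note p3 = axis_path[of i "3 * int m" m]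
  have m1: "0 + int (m - 1) + 1 = int m" using assms(1) by simp
  have m2: "int m + 2 * int (m - 1) + 1 + 1 = 3 * int m" using assms(1) by simp
  have c: "axis_point i t i = t" for t by (simp add: axis_point_def)
  have inj: "axis_point i s = axis_point i t \<longleftrightarrow> s = t" for s t using c by metis
  have d1: "axis_point i ` {0..0 + int (m - 1)} \<inter>
      (\<Union>t\<in>{int m..int m + 2 * int (m - 1) + 1}. grid_layer ?J m i t) = {}"
    using assms(1) by (auto dest!: grid_layer_coord simp: c inj)
  have d2: "(axis_point i ` {0..0 + int (m - 1)} \<union>
      (\<Union>t\<in>{int m..int m + 2 * int (m - 1) + 1}. grid_layer ?J m i t)) \<inter>
      axis_point i ` {3 * int m..3 * int m + int m} = {}"
    using assms(1) by (auto dest!: grid_layer_coord simp: c inj)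
  have a1: "grid_adj (axis_point i (0 + int (m - 1))) (axis_point i (int m))"
    using axis_point_step m1 by metis
  have a2: "grid_adj (axis_point i (int m + 2 * int (m - 1) + 1)) (axis_point i (3 * int m))"
    using axis_point_step m2 by metis
  have len: "m - 1 + (2 * (m - 1) + 1 + 2 * e) + 1 + m + 1 = N"
    using assms(1) N by simp
  have three: "3 * int m + int m = 4 * int m" by simp
  have ax: "axis_point i t \<in> ?V" if "0 \<le> t" "t \<le> 4 * int m" for t
  proof -
    have "0 < t \<Longrightarrow> t < 4 * int m \<Longrightarrow> axis_point i t \<in> edge_region m (\<lambda>_. 0) i"
      using assms(1) by (simp add: edge_region_def axis_point_def)
    then show ?thesis using that by (cases "t = 0"; cases "t = 4 * int m") auto
  qed
  have lay: "x \<in> ?V" if "x \<in> grid_layer ?J m i t" "int m \<le> t" "t < 3 * int m" for x t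
  proof -
    obtain y where y: "y \<in> grid_box ?J m" "x = y(i := t)"
      using \<open>x \<in> grid_layer ?J m i t\<close> by (auto simp: grid_layer_def)
    have "0 \<le> y j \<and> y j < int m" if "j \<noteq> i" for j
      using y(1) that by (auto simp: grid_box_def)
    then have "x \<in> edge_region m (\<lambda>_. 0) i"
      using that(2,3) assms(1) unfolding y(2) edge_region_def
      by (force simp del: fun_upd_apply simp: fun_upd_same fun_upd_other)
    then show ?thesis by blast
  qed
  have sub: "axis_point i ` {0..0 + int (m - 1)} \<union>
      (\<Union>t\<in>{int m..int m + 2 * int (m - 1) + 1}. grid_layer ?J m i t) \<union>
      axis_point i ` {3 * int m..4 * int m} \<subseteq> ?V"
  proof -
    have "axis_point i ` {0..0 + int (m - 1)} \<subseteq> ?V"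
      by (rule image_subsetI, rule ax) auto
    moreover have "axis_point i ` {3 * int m..4 * int m} \<subseteq> ?V"
      by (rule image_subsetI, rule ax) auto
    moreover have "(\<Union>t\<in>{int m..int m + 2 * int (m - 1) + 1}. grid_layer ?J m i t) \<subseteq> ?V"
      by (rule UN_least, rule subsetI, rule lay) (use m2 in auto)
    ultimately show ?thesis by blast
  qed
  have "grid_path (axis_point i ` {0..0 + int (m - 1)} \<union>
      (\<Union>t\<in>{int m..int m + 2 * int (m - 1) + 1}. grid_layer ?J m i t) \<union>
      axis_point i ` {3 * int m..3 * int m + int m})
      (axis_point i 0) (axis_point i (3 * int m + int m)) N"
    using grid_path_join[OF grid_path_join[OF p1 a1 p2 d1] a2 p3 d2, unfolded len] by simp
  then show ?thesis unfolding three by (rule grid_path_mono[OF _ sub])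
qed

lemma edge_grid_path:
  fixes p q :: "'n::finite \<Rightarrow> int"
  assumes "grid_adj p q" "m > 0" "even N" "4 * m \<le> N" "N \<le> 2 * m ^ CARD('n)"
  shows "grid_path (edge_cell m p q) (grid_scale m p) (grid_scale m q) N"
proof -
  have *: "grid_path (edge_cell m u (u(i := u i + 1))) (grid_scale m u)
      (grid_scale m (u(i := u i + 1))) N" for u :: "'n \<Rightarrow> int" and i
  proof -
    let ?h = "\<lambda>x j. grid_scale m u j + x j"
    have h0: "?h (axis_point i 0) = grid_scale m u"
      by (rule ext) (simp add: axis_point_def)
    have h1: "?h (axis_point i (4 * int m)) = grid_scale m (u(i := u i + 1))"
      by (rule ext) (simp add: axis_point_def grid_scale_def algebra_simps)
    have "inj ?h" by (rule injI) (simp add: fun_eq_iff)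
    then have inj: "inj_on ?h V" for V by (rule inj_on_subset) simp
    have "?h ` edge_region m (\<lambda>_. 0) i \<subseteq> edge_region m u i"
      by (auto simp: edge_region_def grid_scale_def)
    then have sub: "?h ` ({axis_point i 0, axis_point i (4 * int m)} \<union> edge_region m (\<lambda>_. 0) i)
        \<subseteq> edge_cell m u (u(i := u i + 1))"
      unfolding edge_cell_def image_Un image_insert h0 h1 by blast
    show ?thesis
      using grid_path_mono[OF grid_path_map[OF axis_grid_path[OF assms(2-), of i] inj
            grid_adj_translate] sub]
      unfolding h0 h1 by blast
  qed
  from assms(1) show ?thesis
    by (cases rule: grid_adj_cases) (use * grid_path_rev edge_cell_commute in metis)+
qed

section \<open>Bounding boxes and disjointness of cells\<close>

lemma edge_region_bounds:
  assumes "x \<in> edge_region m u i" "m > 0"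
  shows "4 * int m * u j - int m \<le> x j"
    and "x j \<le> 4 * int m * (u(i := u i + 1)) j + int m"
  using assms by (cases "j = i"; force simp: edge_region_def algebra_simps abs_less_iff)+

text \<open>In every coordinate a cell leaves the range of its scaled edge by at most
  \<open>m\<close>, which is a quarter of the length of a scaled edge. This is what makes the
  rescaled maps converge.\<close>

lemma edge_cell_bounds:
  assumes "x \<in> edge_cell m p q" "m > 0"
  shows "4 * int m * min (p j) (q j) - int m \<le> x j"
    and "x j \<le> 4 * int m * max (p j) (q j) + int m"
proof -
  have le: "4 * int m * a \<le> 4 * int m * b" if "a \<le> b" for a b
    using that by (simp add: mult_left_mono)
  have p: "4 * int m * min (p j) (q j) - int m \<le> 4 * int m * p j"
    "4 * int m * p j \<le> 4 * int m * max (p j) (q j) + int m"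
    "4 * int m * min (p j) (q j) - int m \<le> 4 * int m * q j"
    "4 * int m * q j \<le> 4 * int m * max (p j) (q j) + int m"
    using le[of "min (p j) (q j)" "p j"] le[of "p j" "max (p j) (q j)"]
      le[of "min (p j) (q j)" "q j"] le[of "q j" "max (p j) (q j)"] by linarith+
  have "4 * int m * min (p j) (q j) - int m \<le> x j \<and> x j \<le> 4 * int m * max (p j) (q j) + int m"
  proof -
    consider "x = grid_scale m p" | "x = grid_scale m q"
      | u i where "{p, q} = {u, u(i := u i + 1)}" "x \<in> edge_region m u i"
      using assms(1) edge_cell_def by blast
    then show ?thesis
    proof cases
      case 3
      have "min (p j) (q j) \<le> u j" "(u(i := u i + 1)) j \<le> max (p j) (q j)"
        using 3(1) by (auto simp: doubleton_eq_iff)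
      from le[OF this(1)] le[OF this(2)] edge_region_bounds[OF 3(2) assms(2), of j]
      show ?thesis by linarith
    qed (use p in \<open>auto simp: grid_scale_def\<close>)
  qed
  then show "4 * int m * min (p j) (q j) - int m \<le> x j"
    "x j \<le> 4 * int m * max (p j) (q j) + int m" by auto
qed

lemma multiple_eq_if_close:
  fixes a b D :: int
  assumes "\<bar>D * a - D * b\<bar> < D"
  shows "a = b"
proof -
  have "\<bar>D\<bar> * \<bar>a - b\<bar> < \<bar>D\<bar> * 1"
    using assms by (simp flip: right_diff_distrib abs_mult)
  then show ?thesis by (subst (asm) mult_less_cancel_left) auto
qed

text \<open>The multiples of \<open>D\<close> nearest to a point strictly between 0 and
  \<open>D\<close> are 0 and \<open>D\<close> themselves.\<close>

lemma abs_add_multiple_ge: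
  fixes a D k :: int
  assumes "0 < a" "a < D"
  shows "min a (D - a) \<le> \<bar>a + D * k\<bar>"
proof (cases "k \<ge> 0")
  case True
  then have "0 \<le> D * k" using assms by simp
  then show ?thesis by linarith
next
  case False
  then have "D * k \<le> D * (- 1)" using assms by (intro mult_left_mono) auto
  then show ?thesis by linarith
qed

(* The direction i is the unique coordinate in which x is farthest from the multiples of 4m. *)
lemma edge_region_inter:
  assumes "x \<in> edge_region m u i" "x \<in> edge_region m w k"
  shows "u = w \<and> i = k"
proof -
  let ?D = "4 * int m"
  have u: "0 < x i - ?D * u i" "x i - ?D * u i < ?D"
    "\<And>j. j \<noteq> i \<Longrightarrow> \<bar>x j - ?D * u j\<bar> < int m"
    "\<And>j. j \<noteq> i \<Longrightarrow> \<bar>x j - ?D * u j\<bar> < min (x i - ?D * u i) (?D - (x i - ?D * u i))"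
    using assms(1) unfolding edge_region_def by auto
  have w: "0 < x k - ?D * w k" "x k - ?D * w k < ?D"
    "\<And>j. j \<noteq> k \<Longrightarrow> \<bar>x j - ?D * w j\<bar> < int m"
    "\<And>j. j \<noteq> k \<Longrightarrow> \<bar>x j - ?D * w j\<bar> < min (x k - ?D * w k) (?D - (x k - ?D * w k))"
    using assms(2) unfolding edge_region_def by auto
  have ik: "i = k"
  proof (rule ccontr)
    assume ne: "i \<noteq> k"
    have "min (x i - ?D * u i) (?D - (x i - ?D * u i)) \<le> \<bar>x i - ?D * w i\<bar>"
      using abs_add_multiple_ge[OF u(1,2), of "u i - w i"] by (simp add: algebra_simps)
    moreover have "min (x k - ?D * w k) (?D - (x k - ?D * w k)) \<le> \<bar>x k - ?D * u k\<bar>"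
      using abs_add_multiple_ge[OF w(1,2), of "w k - u k"] by (simp add: algebra_simps)
    ultimately show False using u(4)[of k] w(4)[of i] ne by force
  qed
  have "u j = w j" for j
  proof (rule multiple_eq_if_close[of ?D])
    show "\<bar>?D * u j - ?D * w j\<bar> < ?D"
      using u(1,2) u(3)[of j] w(1,2) w(3)[of j] ik by (cases "j = i") auto
  qed
  then show ?thesis using ik by auto
qed

text \<open>In direction \<open>i\<close> the region lies strictly between two successive multiples
  of \<open>4 * m\<close>.\<close>

lemma grid_scale_notin_edge_region: "grid_scale m w \<notin> edge_region m u i"
proof
  assume *: "grid_scale m w \<in> edge_region m u i"
  then have "w i = u i"
    by (intro multiple_eq_if_close[of "4 * int m"]) (auto simp: edge_region_def grid_scale_def)
  then show False using * by (auto simp: edge_region_def grid_scale_def)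
qed

lemma grid_scale_eq_iff: "m > 0 \<Longrightarrow> grid_scale m p = grid_scale m q \<longleftrightarrow> p = q"
  by (auto simp: grid_scale_def fun_eq_iff)

text \<open>Different edges have disjoint regions, and regions contain no scaled lattice points, so
  two cells can share nothing but an apex.\<close>

lemma edge_cell_inter:
  assumes "x \<in> edge_cell m p q" "x \<in> edge_cell m p' q'" "m > 0" "{p, q} \<noteq> {p', q'}"
  obtains u where "u \<in> {p, q}" "u \<in> {p', q'}" "x = grid_scale m u"
proof -
  have "\<exists>u. u \<in> {p, q} \<and> x = grid_scale m u"
    if "x \<in> edge_cell m p q" "x \<in> edge_cell m p' q'" "{p, q} \<noteq> {p', q'}" for p q p' q'
    using that grid_scale_notin_edge_region edge_region_inter unfolding edge_cell_def
    by (smt (verit) Un_iff insert_iff mem_Collect_eq singletonD)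
  then show ?thesis using assms that grid_scale_eq_iff by metis
qed

text \<open>The bounding box of a grid edge is a unit segment, whose only lattice points are its
  ends.\<close>

lemma grid_edge_endpoint:
  assumes "grid_adj p q" "\<And>j. min (p j) (q j) \<le> z j" "\<And>j. z j \<le> max (p j) (q j)"
  shows "z = p \<or> z = q"
proof -
  have *: "z = p \<or> z = q" if "q = p(i := p i + 1)"
    "\<And>j. min (p j) (q j) \<le> z j" "\<And>j. z j \<le> max (p j) (q j)" for p q :: "'a \<Rightarrow> int" and i
  proof -
    have "z j = p j" if "j \<noteq> i" for j
      using that \<open>q = _\<close> \<open>\<And>j. min (p j) (q j) \<le> z j\<close>[of j] \<open>\<And>j. z j \<le> max (p j) (q j)\<close>[of j] by auto
    moreover have "z i = p i \<or> z i = p i + 1"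
      using \<open>q = _\<close> that(2)[of i] that(3)[of i] by auto
    ultimately have "z = p(i := p i) \<or> z = p(i := p i + 1)"
      by (metis fun_upd_idem_iff fun_upd_triv fun_upd_apply ext)
    then show ?thesis using that(1) by simp
  qed
  from assms(1) show ?thesis
  proof (cases rule: grid_adj_cases)
    case (1 i) then show ?thesis using * assms(2,3) by blast
  next
    case (2 i) then show ?thesis using *[OF 2] assms(2,3) by (metis min.commute max.commute)
  qed
qed

(* Otherwise the coordinatewise maximum of the lower corners is a common lattice point of both edges. *)
lemma grid_edges_separated:
  assumes "grid_adj p q" "grid_adj p' q'" "{p, q} \<inter> {p', q'} = {}"
  shows "\<exists>j. max (p j) (q j) + 1 \<le> min (p' j) (q' j) \<or> max (p' j) (q' j) + 1 \<le> min (p j) (q j)"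
proof (rule ccontr)
  assume no: "\<not> ?thesis"
  define z where "z j = max (min (p j) (q j)) (min (p' j) (q' j))" for j
  have "min (p j) (q j) \<le> z j" "z j \<le> max (p j) (q j)"
    "min (p' j) (q' j) \<le> z j" "z j \<le> max (p' j) (q' j)" for j
    using no unfolding z_def by (auto simp: not_le) (smt (verit))+
  then have "z = p \<or> z = q" "z = p' \<or> z = q'"
    using grid_edge_endpoint assms(1,2) by blast+
  then show False using assms(3) by blast
qed

section \<open>Chains of grid edges over partitions\<close>

text \<open>Pairs related in this way are the pieces into which the cut points \<open>T\<close>
  divide the arc.\<close>

definition consecutive :: "real set \<Rightarrow> real \<Rightarrow> real \<Rightarrow> bool"
  where "consecutive T a b \<longleftrightarrow> a \<in> T \<and> b \<in> T \<and> a < b \<and> T \<inter> {a<..<b} = {}"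

lemma consecutive_exists:
  assumes "finite T" "a \<in> T" "b \<in> T" "a < b" "a \<le> x" "x \<le> b"
  obtains u w where "consecutive T u w" "a \<le> u" "u \<le> x" "x \<le> w" "w \<le> b"
proof (cases "x < b")
  case True
  define u where "u = Max {t \<in> T. t \<le> x}"
  define w where "w = Min {t \<in> T. x < t}"
  have "u \<in> {t \<in> T. t \<le> x}" unfolding u_def by (rule Max_in) (use assms in auto)
  moreover have "w \<in> {t \<in> T. x < t}" unfolding w_def by (rule Min_in) (use assms True in auto)
  moreover have u: "t \<le> u" if "t \<in> T" "t \<le> x" for t
    unfolding u_def using that assms(1) by auto
  moreover have w: "w \<le> t" if "t \<in> T" "x < t" for t
    unfolding w_def using that assms(1) by auto
  ultimately have "consecutive T u w" unfolding consecutive_def by force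
  then show ?thesis
    using that \<open>u \<in> _\<close> \<open>w \<in> _\<close> u[of a] w[of b] assms True by auto
next
  \<comment> \<open>The right end has no cut point beyond it to serve as upper end, so it is
    assigned to the piece on its left.\<close>
  case False
  then have x: "x = b" using assms by simp
  define u where "u = Max {t \<in> T. t < b}"
  have "u \<in> {t \<in> T. t < b}" unfolding u_def by (rule Max_in) (use assms in auto)
  moreover have u: "t \<le> u" if "t \<in> T" "t < b" for t
    unfolding u_def using that assms(1) by auto
  ultimately have "consecutive T u b" using assms(3) unfolding consecutive_def by force
  then show ?thesis using that \<open>u \<in> _\<close> u[of a] assms x by auto
qed

lemma consecutive_cases:
  assumes "consecutive T a b" "consecutive T a' b'"
  obtains "a = a'" "b = b'" | "b \<le> a'" | "b' \<le> a"
proof -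
  have "a = a' \<and> b = b' \<or> b \<le> a' \<or> b' \<le> a"
  proof (rule ccontr)
    assume no: "\<not> ?thesis"
    have "a' \<notin> {a<..<b}" "b' \<notin> {a<..<b}" "a \<notin> {a'<..<b'}" "b \<notin> {a'<..<b'}" "a < b" "a' < b'"
      using assms unfolding consecutive_def by blast+
    then show False using no by force
  qed
  then show ?thesis using that by blast
qed

section \<open>Subarcs matched with lattice edges, and their refinement\<close>

text \<open>\<open>D x y\<close> stands for the size of the piece from \<open>x\<close> to
  \<open>y\<close>, later the diameter of that subarc, and \<open>r\<close> for the scale of the
  generation.\<close>

definition grid_chain ::
  "(real \<Rightarrow> real \<Rightarrow> real) \<Rightarrow> real \<Rightarrow> real \<Rightarrow> real \<Rightarrow> real set \<Rightarrow> (real \<Rightarrow> 'n \<Rightarrow> int) \<Rightarrow> bool"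
  where "grid_chain D r a b T v \<longleftrightarrow>
    finite T \<and> a \<in> T \<and> b \<in> T \<and> T \<subseteq> {a..b} \<and> inj_on v T \<and>
    (\<forall>x y. consecutive T x y \<longrightarrow> grid_adj (v x) (v y) \<and> r \<le> D x y \<and> D x y \<le> 3 * r)"

text \<open>The \<open>k\<close>-th cut point is sent to the \<open>k\<close>-th vertex of the path.
  As \<open>t\<close> is strictly increasing, consecutive cut points have successive indices and so
  receive neighbouring vertices.\<close>

lemma grid_chain_of_path:
  assumes mono: "\<And>k. k < N \<Longrightarrow> t k < t (Suc k)" and ends: "t 0 = a" "t N = b"
    and D: "\<And>k. k < N \<Longrightarrow> r \<le> D (t k) (t (Suc k)) \<and> D (t k) (t (Suc k)) \<le> 3 * r"
    and path: "grid_path V p q N"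
  shows "\<exists>T w. grid_chain D r a b T w \<and> w a = p \<and> w b = q \<and> w ` T \<subseteq> V"
proof -
  obtain z where z: "z 0 = p" "z N = q" "inj_on z {..N}" "z ` {..N} \<subseteq> V"
    "\<forall>k<N. grid_adj (z k) (z (Suc k))"
    using path grid_path_def by blast
  have less: "t j < t k" if "j < k" "k \<le> N" for j k
    using that
  proof (induction k)
    case (Suc k)
    then have "t j \<le> t k" by (cases "j = k") auto
    then show ?case using mono[of k] Suc by auto
  qed simp
  have inj: "inj_on t {..N}"
    by (rule inj_onI) (metis atMost_iff less linorder_less_linear order_less_irrefl)
  define w where "w = z \<circ> the_inv_into {..N} t"
  have w: "w (t k) = z k" if "k \<le> N" for k
    using that the_inv_into_f_f[OF inj] by (simp add: w_def)
  let ?T = "t ` {..N}"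
  have cons: "\<exists>k<N. x = t k \<and> y = t (Suc k)" if "consecutive ?T x y" for x y
  proof -
    have xy: "x \<in> ?T" "y \<in> ?T" "x < y" using that unfolding consecutive_def by auto
    obtain j where j: "x = t j" "j \<le> N" using xy(1) by auto
    obtain l where l: "y = t l" "l \<le> N" using xy(2) by auto
    note jl = j(1) l(1) j(2) l(2) xy(3)[unfolded j(1) l(1)]
    have "j < l" using jl less by (metis not_less_iff_gr_or_eq order_less_asym)
    have "\<not> Suc j < l"
    proof
      assume "Suc j < l"
      then have "t (Suc j) \<in> ?T \<inter> {x<..<y}" using jl less by auto
      then show False using that unfolding consecutive_def by blast
    qed
    then have "l = Suc j" using \<open>j < l\<close> by simp
    then show ?thesis using jl by (intro exI[of _ j]) auto
  qed
  have "grid_chain D r a b ?T w"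
    unfolding grid_chain_def
  proof (intro conjI allI impI)
    show "a \<in> ?T" "b \<in> ?T" using ends by auto
    show "?T \<subseteq> {a..b}"
    proof
      fix x assume "x \<in> ?T"
      then obtain k where k: "k \<le> N" "x = t k" by auto
      have "a \<le> x" using less[of 0 k] k ends by (cases "k = 0") auto
      moreover have "x \<le> b" using less[of k N] k ends by (cases "k = N") auto
      ultimately show "x \<in> {a..b}" by simp
    qed
    show "inj_on w ?T"
      using z(3) w by (auto simp: inj_on_def)
    fix x y assume "consecutive ?T x y"
    then obtain k where k: "k < N" "x = t k" "y = t (Suc k)" using cons by blast
    show "grid_adj (w x) (w y)" using k z(5) w by simp
    show "r \<le> D x y" "D x y \<le> 3 * r" using D k by auto
  qed simp
  moreover have "w a = p" "w b = q" using w[of 0] w[of N] ends z by auto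
  moreover have "w ` ?T \<subseteq> V" using w z(4) by auto
  ultimately show ?thesis by blast
qed

text \<open>Only the containment in cells is recorded, since the passage to the limit uses nothing
  else about the relation of \<open>v'\<close> to \<open>v\<close>.\<close>

definition grid_refines ::
  "nat \<Rightarrow> real set \<Rightarrow> (real \<Rightarrow> 'n \<Rightarrow> int) \<Rightarrow> real set \<Rightarrow> (real \<Rightarrow> 'n \<Rightarrow> int) \<Rightarrow> bool"
  where "grid_refines m T v T' v' \<longleftrightarrow> T \<subseteq> T' \<and>
    (\<forall>a b. consecutive T a b \<longrightarrow> (\<forall>t\<in>T' \<inter> {a..b}. v' t \<in> edge_cell m (v a) (v b)))"

text \<open>The local chains agree at common endpoints, where both take the scaled old value, and
  can therefore be glued. Global injectivity comes from the disjointness of cells of different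
  edges.\<close>

lemma grid_chain_refine:
  fixes v :: "real \<Rightarrow> 'n \<Rightarrow> int"
  assumes chain: "grid_chain D R lo hi T v" and "lo < hi" "m > 0"
    and loc: "\<And>a b. consecutive T a b \<Longrightarrow> \<exists>S w. grid_chain D r a b S w \<and>
        w a = grid_scale m (v a) \<and> w b = grid_scale m (v b) \<and> w ` S \<subseteq> edge_cell m (v a) (v b)"
  shows "\<exists>T' v'. grid_chain D r lo hi T' v' \<and> grid_refines m T v T' v'"
proof -
  have T: "finite T" "lo \<in> T" "hi \<in> T" "T \<subseteq> {lo..hi}" "inj_on v T"
    using chain unfolding grid_chain_def by auto
  obtain S w where Sw: "\<And>a b. consecutive T a b \<Longrightarrow> grid_chain D r a b (S a b) (w a b) \<and>
        w a b a = grid_scale m (v a) \<and> w a b b = grid_scale m (v b) \<and>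
        w a b ` S a b \<subseteq> edge_cell m (v a) (v b)"
    using loc by metis
  define T' where "T' = (\<Union>(a, b)\<in>{(a, b). consecutive T a b}. S a b)"
  \<comment> \<open>The choice is harmless: a point in two of the sets \<open>S a b\<close> is a
    common endpoint of their pieces, and the local maps agree there.\<close>
  define v' where "v' t = (SOME y. \<exists>a b. consecutive T a b \<and> t \<in> S a b \<and> y = w a b t)" for t
  have S: "finite (S a b)" "a \<in> S a b" "b \<in> S a b" "S a b \<subseteq> {a..b}" "inj_on (w a b) (S a b)"
    if "consecutive T a b" for a b
    using Sw[OF that] unfolding grid_chain_def by auto
  have uniq: "w a b t = w a' b' t"
    if c: "consecutive T a b" "consecutive T a' b'" and t: "t \<in> S a b" "t \<in> S a' b'" for a b a' b' t
    using consecutive_cases[OF c]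
  proof cases
    case 2
    then have "t = b" "t = a'" using S(4)[OF c(1)] S(4)[OF c(2)] t by force+
    then show ?thesis using Sw[OF c(1)] Sw[OF c(2)] by auto
  next
    case 3
    then have "t = b'" "t = a" using S(4)[OF c(1)] S(4)[OF c(2)] t by force+
    then show ?thesis using Sw[OF c(1)] Sw[OF c(2)] by auto
  qed auto
  have v': "v' t = w a b t" if "consecutive T a b" "t \<in> S a b" for a b t
    unfolding v'_def
  proof (rule some_equality)
    show "\<exists>a' b'. consecutive T a' b' \<and> t \<in> S a' b' \<and> w a b t = w a' b' t" using that by blast
  qed (use that uniq in blast)
  have in_S: "t \<in> S a b" if c: "consecutive T a b" and t: "t \<in> T'" "a \<le> t" "t \<le> b" for a b t
  proof -
    obtain a' b' where c': "consecutive T a' b'" "t \<in> S a' b'" using t(1) T'_def by auto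
    from c c'(1) show ?thesis
    proof (cases rule: consecutive_cases)
      case 2
      then have "t = b" using S(4)[OF c'(1)] c'(2) t by force
      then show ?thesis using S(3)[OF c] by simp
    next
      case 3
      then have "t = a" using S(4)[OF c'(1)] c'(2) t by force
      then show ?thesis using S(2)[OF c] by simp
    qed (use c' in auto)
  qed
  have sub: "S a b \<subseteq> T'" if "consecutive T a b" for a b
    using that unfolding T'_def by auto
  have TT': "T \<subseteq> T'"
  proof
    fix t assume t: "t \<in> T"
    then have "lo \<le> t" "t \<le> hi" using T(4) by auto
    then obtain a b where ab: "consecutive T a b" "a \<le> t" "t \<le> b"
      using consecutive_exists[OF T(1-3) assms(2)] by metis
    then have "t = a \<or> t = b" using t unfolding consecutive_def by force
    then show "t \<in> T'" using S(2,3)[OF ab(1)] sub[OF ab(1)] by auto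
  qed
  have "finite {(a, b). consecutive T a b}"
    by (rule finite_subset[of _ "T \<times> T"]) (use T(1) in \<open>auto simp: consecutive_def\<close>)
  then have fin: "finite T'"
    unfolding T'_def using S(1) by auto
  have T'_sub: "T' \<subseteq> {lo..hi}"
  proof
    fix t assume "t \<in> T'"
    then obtain a b where c: "consecutive T a b" "t \<in> S a b" unfolding T'_def by auto
    then have "a \<in> {lo..hi}" "b \<in> {lo..hi}" using T(4) unfolding consecutive_def by auto
    then show "t \<in> {lo..hi}" using S(4)[OF c(1)] c(2) by auto
  qed
  have inj: "inj_on v' T'"
  proof (rule inj_onI)
    fix s t assume st: "s \<in> T'" "t \<in> T'" "v' s = v' t"
    obtain a b where ab: "consecutive T a b" "s \<in> S a b" using st(1) T'_def by auto
    obtain a' b' where ab': "consecutive T a' b'" "t \<in> S a' b'" using st(2) T'_def by auto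
    have in_T: "a \<in> T" "b \<in> T" "a' \<in> T" "b' \<in> T" "a < b" "a' < b'"
      using ab(1) ab'(1) unfolding consecutive_def by auto
    show "s = t"
    proof (cases "a = a' \<and> b = b'")
      case True
      then show ?thesis using st(3) ab ab' v' S(5) by (metis inj_onD)
    next
      case False
      \<comment> \<open>As \<open>v\<close> is injective, different pieces have different lattice
        edges. A common value must then be the scaled image of a shared endpoint, and local
        injectivity identifies \<open>s\<close> and \<open>t\<close> with that endpoint.\<close>
      then have "{a, b} \<noteq> {a', b'}" using in_T(5,6) by (auto simp: doubleton_eq_iff)
      then have "v ` {a, b} \<noteq> v ` {a', b'}"
        using inj_on_image_eq_iff[OF T(5), of "{a, b}" "{a', b'}"] in_T by blast
      then have ne: "{v a, v b} \<noteq> {v a', v b'}" by simp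
      have "v' s \<in> edge_cell m (v a) (v b)" "v' s \<in> edge_cell m (v a') (v b')"
        using v'[OF ab] v'[OF ab'] st(3) Sw[OF ab(1)] Sw[OF ab'(1)] ab(2) ab'(2) by auto
      from edge_cell_inter[OF this assms(3) ne]
      obtain u where u: "u \<in> {v a, v b}" "u \<in> {v a', v b'}" "v' s = grid_scale m u" by blast
      obtain e where e: "e \<in> {a, b}" "u = v e" using u(1) by auto
      obtain e' where e': "e' \<in> {a', b'}" "u = v e'" using u(2) by auto
      have "e = e'" using e e' in_T T(5) by (metis inj_onD insert_iff singletonD)
      have "w a b e = w a b s" "e \<in> S a b"
        using Sw[OF ab(1)] e u(3) v'[OF ab] S(2,3)[OF ab(1)] by auto
      then have "e = s" using S(5)[OF ab(1)] ab(2) by (meson inj_onD)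
      have "w a' b' e' = w a' b' t" "e' \<in> S a' b'"
        using Sw[OF ab'(1)] e' u(3) st(3) v'[OF ab'] S(2,3)[OF ab'(1)] by auto
      then have "e' = t" using S(5)[OF ab'(1)] ab'(2) by (meson inj_onD)
      then show ?thesis using \<open>e = s\<close> \<open>e = e'\<close> by simp
    qed
  qed
  have cons: "grid_adj (v' x) (v' y) \<and> r \<le> D x y \<and> D x y \<le> 3 * r" if c: "consecutive T' x y" for x y
  proof -
    have xy: "x \<in> T'" "y \<in> T'" "x < y" "T' \<inter> {x<..<y} = {}" using c unfolding consecutive_def by auto
    \<comment> \<open>The midpoint locates the old piece that contains the new one: old cut points
      are also new ones, so none lies strictly between \<open>x\<close> and
      \<open>y\<close>.\<close>
    have "lo \<le> (x + y) / 2" "(x + y) / 2 \<le> hi" using xy T'_sub by force+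
    then obtain a b where ab: "consecutive T a b" "a \<le> (x + y) / 2" "(x + y) / 2 \<le> b"
      using consecutive_exists[OF T(1-3) assms(2)] by metis
    have "a \<in> T'" "b \<in> T'" using ab(1) TT' unfolding consecutive_def by auto
    then have "a \<notin> {x<..<y}" "b \<notin> {x<..<y}" using xy(4) by blast+
    then have "a \<le> x" "y \<le> b" using ab(2,3) xy(3) by auto
    then have xS: "x \<in> S a b" "y \<in> S a b" using in_S[OF ab(1)] xy by auto
    then have "consecutive (S a b) x y"
      using xy sub[OF ab(1)] unfolding consecutive_def by blast
    then show ?thesis
      using Sw[OF ab(1)] v'[OF ab(1)] xS unfolding grid_chain_def by auto
  qed
  have "grid_chain D r lo hi T' v'"
    unfolding grid_chain_def using fin TT' T T'_sub inj cons by blast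
  moreover have "grid_refines m T v T' v'"
    unfolding grid_refines_def using TT' in_S v' Sw by fastforce
  ultimately show ?thesis by blast
qed

section \<open>The limit of a sequence of refinements\<close>

text \<open>A cut point belongs to two pieces of the same generation. The pieces are therefore
  chosen successively, each inside its predecessor.\<close>

lemma nested_pieces:
  fixes T :: "nat \<Rightarrow> real set"
  assumes "\<And>k. finite (T k)" "\<And>k. T k \<subseteq> T (Suc k)" "a \<in> T 0" "b \<in> T 0" "a < b" "a \<le> x" "x \<le> b"
  shows "\<exists>A B. \<forall>k. consecutive (T k) (A k) (B k) \<and> A k \<le> x \<and> x \<le> B k \<and>
    A k \<le> A (Suc k) \<and> B (Suc k) \<le> B k"
proof -
  have "\<exists>f. \<forall>k. (consecutive (T k) (fst (f k)) (snd (f k)) \<and> fst (f k) \<le> x \<and> x \<le> snd (f k)) \<and>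
      fst (f k) \<le> fst (f (Suc k)) \<and> snd (f (Suc k)) \<le> snd (f k)"
  proof (rule dependent_nat_choice)
    obtain u w where "consecutive (T 0) u w" "u \<le> x" "x \<le> w"
      using consecutive_exists[OF assms(1) assms(3-)] by blast
    then show "\<exists>p. consecutive (T 0) (fst p) (snd p) \<and> fst p \<le> x \<and> x \<le> snd p"
      by (intro exI[of _ "(u, w)"]) simp
  next
    fix p k assume p: "consecutive (T k) (fst p) (snd p) \<and> fst p \<le> x \<and> x \<le> snd p"
    then have "fst p \<in> T (Suc k)" "snd p \<in> T (Suc k)" "fst p < snd p"
      using assms(2)[of k] unfolding consecutive_def by auto
    from consecutive_exists[OF assms(1) this] p
    obtain u w where "consecutive (T (Suc k)) u w" "u \<le> x" "x \<le> w" "fst p \<le> u" "w \<le> snd p"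
      by metis
    then show "\<exists>p'. (consecutive (T (Suc k)) (fst p') (snd p') \<and> fst p' \<le> x \<and> x \<le> snd p') \<and>
        fst p \<le> fst p' \<and> snd p' \<le> snd p"
      by (intro exI[of _ "(u, w)"]) simp
  qed
  then obtain f where f: "\<forall>k. (consecutive (T k) (fst (f k)) (snd (f k)) \<and> fst (f k) \<le> x \<and> x \<le> snd (f k)) \<and>
      fst (f k) \<le> fst (f (Suc k)) \<and> snd (f (Suc k)) \<le> snd (f k)" ..
  show ?thesis
    by (intro exI[of _ "\<lambda>k. fst (f k)"] exI[of _ "\<lambda>k. snd (f k)"] allI) (simp add: f)
qed

lemma nested_interval_point:
  fixes \<alpha> \<beta> :: "nat \<Rightarrow> real"
  assumes "\<And>k. \<alpha> k \<le> \<alpha> (Suc k)" "\<And>k. \<beta> (Suc k) \<le> \<beta> k" "\<And>k. \<alpha> k \<le> \<beta> k"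
  shows "\<exists>x. \<forall>k. \<alpha> k \<le> x \<and> x \<le> \<beta> k"
proof -
  have le: "\<alpha> j \<le> \<beta> k" for j k
  proof -
    have "\<alpha> j \<le> \<alpha> (max j k)" by (rule lift_Suc_mono_le[of \<alpha>, OF assms(1) max.cobounded1])
    also have "\<dots> \<le> \<beta> (max j k)" by (rule assms(3))
    also have "\<dots> \<le> \<beta> k" by (rule lift_Suc_antimono_le[of \<beta>, OF assms(2) max.cobounded2])
    finally show ?thesis .
  qed
  have bdd: "bdd_above (range \<alpha>)" by (rule bdd_aboveI2[of _ _ "\<beta> 0"]) (rule le)
  show ?thesis
  proof (intro exI[of _ "SUP j. \<alpha> j"] allI conjI)
    show "\<alpha> k \<le> (SUP j. \<alpha> j)" for k by (rule cSUP_upper[OF UNIV_I bdd])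
    show "(SUP j. \<alpha> j) \<le> \<beta> k" for k by (rule cSUP_least[OF UNIV_not_empty le])
  qed
qed

(* The margin 1/3 absorbs all later excursions, since m + 1/3 \<le> 4m/3. *)
lemma grid_boxes_nested:
  fixes lo hi lo' hi' :: int and M :: real
  assumes "m > 0" "M > 0"
    and "4 * int m * lo - int m \<le> lo'" "hi' \<le> 4 * int m * hi + int m"
  shows "(lo - 1 / 3) / M \<le> (lo' - 1 / 3) / (4 * real m * M)"
    and "(hi' + 1 / 3) / (4 * real m * M) \<le> (hi + 1 / 3) / M"
proof -
  have m: "real m \<ge> 1" using assms(1) by simp
  have "real_of_int (4 * int m * lo - int m) \<le> lo'" "hi' \<le> real_of_int (4 * int m * hi + int m)"
    using assms(3,4) by (simp_all only: of_int_le_iff)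
  then have *: "4 * real m * (lo - 1 / 3) \<le> lo' - 1 / 3" "hi' + 1 / 3 \<le> 4 * real m * (hi + 1 / 3)"
    using m by (simp_all add: algebra_simps)
  have "(lo - 1 / 3) / M = (4 * real m * (lo - 1 / 3)) / (4 * real m * M)" using m by simp
  also have "\<dots> \<le> (lo' - 1 / 3) / (4 * real m * M)"
    using *(1) assms(1,2) by (intro divide_right_mono) auto
  finally show "(lo - 1 / 3) / M \<le> (lo' - 1 / 3) / (4 * real m * M)" .
  have "(hi' + 1 / 3) / (4 * real m * M) \<le> (4 * real m * (hi + 1 / 3)) / (4 * real m * M)"
    using *(2) assms(1,2) by (intro divide_right_mono) auto
  also have "\<dots> = (hi + 1 / 3) / M" using m by simp
  finally show "(hi' + 1 / 3) / (4 * real m * M) \<le> (hi + 1 / 3) / M" .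
qed

text \<open>Around \<open>x\<close>, the bounding boxes of the lattice edges, enlarged by 1/3 and
  rescaled, form a nested sequence. The limit \<open>F\<close> is obtained coordinatewise as a point
  common to all of them.\<close>

lemma limit_point_of_refinements:
  fixes T :: "nat \<Rightarrow> real set" and v :: "nat \<Rightarrow> real \<Rightarrow> 'n \<Rightarrow> int"
  assumes m: "m > 0" and fin: "\<And>k. finite (T k)"
    and ref: "\<And>k. grid_refines m (T k) (v k) (T (Suc k)) (v (Suc k))"
    and T0: "a \<in> T 0" "b \<in> T 0" "a < b" "a \<le> x" "x \<le> b"
  shows "\<exists>A B F. \<forall>k. consecutive (T k) (A k) (B k) \<and> A k \<le> x \<and> x \<le> B k \<and>
    (\<forall>c. (min (v k (A k) c) (v k (B k) c) - 1 / 3) / (4 * real m) ^ k \<le> F c \<and>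
      F c \<le> (max (v k (A k) c) (v k (B k) c) + 1 / 3) / (4 * real m) ^ k)"
proof -
  have sub: "T k \<subseteq> T (Suc k)" for k using ref unfolding grid_refines_def by blast
  obtain A B where AB: "\<And>k. consecutive (T k) (A k) (B k)" "\<And>k. A k \<le> x" "\<And>k. x \<le> B k"
    "\<And>k. A k \<le> A (Suc k)" "\<And>k. B (Suc k) \<le> B k"
    using nested_pieces[OF fin sub T0] by metis
  let ?lo = "\<lambda>k c. min (v k (A k) c) (v k (B k) c)"
  let ?hi = "\<lambda>k c. max (v k (A k) c) (v k (B k) c)"
  let ?\<alpha> = "\<lambda>c k. (?lo k c - 1 / 3) / (4 * real m) ^ k"
  let ?\<beta> = "\<lambda>c k. (?hi k c + 1 / 3) / (4 * real m) ^ k"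
  have cell: "v (Suc k) t \<in> edge_cell m (v k (A k)) (v k (B k))"
    if "t = A (Suc k) \<or> t = B (Suc k)" for k t
  proof -
    have "A (Suc k) \<in> T (Suc k)" "B (Suc k) \<in> T (Suc k)" "A (Suc k) < B (Suc k)"
      using AB(1)[of "Suc k"] unfolding consecutive_def by auto
    then have "t \<in> T (Suc k) \<inter> {A k..B k}"
      using that AB(4)[of k] AB(5)[of k] by auto
    then show ?thesis using ref[of k] AB(1)[of k] unfolding grid_refines_def by blast
  qed
  have nest: "4 * int m * ?lo k c - int m \<le> ?lo (Suc k) c"
    "?hi (Suc k) c \<le> 4 * int m * ?hi k c + int m" for k c
    using edge_cell_bounds[OF cell m, of "A (Suc k)" k c] edge_cell_bounds[OF cell m, of "B (Suc k)" k c]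
    by (simp_all only: min_le_iff_disj le_max_iff_disj min.bounded_iff max.bounded_iff simp_thms)
  have "\<exists>y. \<forall>k. ?\<alpha> c k \<le> y \<and> y \<le> ?\<beta> c k" for c
  proof (rule nested_interval_point)
    fix k
    have M: "(4 * real m) ^ k > 0" using m by simp
    show "?\<alpha> c k \<le> ?\<alpha> c (Suc k)" "?\<beta> c (Suc k) \<le> ?\<beta> c k"
      using grid_boxes_nested[OF m M nest[of k c]] by simp_all
    show "?\<alpha> c k \<le> ?\<beta> c k" using M by (intro divide_right_mono) auto
  qed
  then have "\<exists>F. \<forall>c k. ?\<alpha> c k \<le> F c \<and> F c \<le> ?\<beta> c k"
    by (intro choice allI)
  then obtain F where F: "\<forall>c k. ?\<alpha> c k \<le> F c \<and> F c \<le> ?\<beta> c k" ..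
  show ?thesis
    by (intro exI[of _ A] exI[of _ B] exI[of _ F] allI conjI) (simp_all only: AB F)
qed

section \<open>Comparing the limits of two points\<close>

lemma grid_adj_coord:
  assumes "grid_adj p q"
  shows "max (p c) (q c) \<le> min (p c) (q c) + 1"
  using assms
proof (cases rule: grid_adj_cases)
  case (1 i)
  show ?thesis unfolding 1 by simp
next
  case (2 i)
  show ?thesis unfolding 2 by simp
qed

text \<open>Two unit ranges with a common point span at most 2, and the two margins add 2/3, which
  is less than 3 in total.\<close>

lemma boxes_meet:
  fixes lo hi lo' hi' w :: int and M x y :: real
  assumes "lo \<le> w" "w \<le> hi" "lo' \<le> w" "w \<le> hi'" "hi \<le> lo + 1" "hi' \<le> lo' + 1" "M > 0"
    and "(lo - 1 / 3) / M \<le> x \<and> x \<le> (hi + 1 / 3) / M" "(lo' - 1 / 3) / M \<le> y \<and> y \<le> (hi' + 1 / 3) / M"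
  shows "\<bar>x - y\<bar> \<le> 3 / M"
proof -
  have "hi - lo' \<le> 2" "hi' - lo \<le> 2" using assms(1-6) by linarith+
  then have "real_of_int hi - lo' \<le> 2" "real_of_int hi' - lo \<le> 2" by linarith+
  then have "(hi + 1 / 3) / M - (lo' - 1 / 3) / M \<le> 3 / M" "(hi' + 1 / 3) / M - (lo - 1 / 3) / M \<le> 3 / M"
    unfolding diff_divide_distrib[symmetric] using assms(7) by (intro divide_right_mono; simp)+
  then show ?thesis using assms(8,9) by linarith
qed

text \<open>Of a gap of length 1 the two margins of 1/3 leave 1/3.\<close>

lemma boxes_apart:
  fixes lo hi lo' hi' :: int and M x y :: real
  assumes "hi + 1 \<le> lo'" "M > 0"
    and "(lo - 1 / 3) / M \<le> x \<and> x \<le> (hi + 1 / 3) / M" "(lo' - 1 / 3) / M \<le> y \<and> y \<le> (hi' + 1 / 3) / M"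
  shows "1 / 3 / M \<le> \<bar>x - y\<bar>"
proof -
  have "real_of_int hi + 1 \<le> lo'" using assms(1) by linarith
  then have "1 / 3 / M \<le> (lo' - 1 / 3) / M - (hi + 1 / 3) / M"
    unfolding diff_divide_distrib[symmetric] using assms(2) by (intro divide_right_mono; simp)
  then show ?thesis using assms(3,4) by linarith
qed

text \<open>For given \<open>x\<close> and \<open>y\<close> there is a generation \<open>j\<close>
  at which their pieces share an endpoint while those of generation \<open>j + 1\<close> do not. The
  former bounds both \<open>D x y\<close> and the distance of the images from above, the latter
  bounds both from below, and the scales differ only by the factor \<open>4 * m\<close>.\<close>

lemma embedding_of_refinements:
  fixes D :: "real \<Rightarrow> real \<Rightarrow> real" and v :: "nat \<Rightarrow> real \<Rightarrow> 'n::finite \<Rightarrow> int"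
  assumes m: "m > 0" and R: "R > 0"
    and chain: "\<And>k. grid_chain D (R / (4 * real m) ^ k) 0 1 (T k) (v k)"
    and ref: "\<And>k. grid_refines m (T k) (v k) (T (Suc k)) (v (Suc k))"
    and T0: "T 0 = {0, 1}"
    and mono: "\<And>a b a' b'. 0 \<le> a \<Longrightarrow> a \<le> a' \<Longrightarrow> a' \<le> b' \<Longrightarrow> b' \<le> b \<Longrightarrow> b \<le> 1 \<Longrightarrow> D a' b' \<le> D a b"
    and tri: "\<And>a b c. 0 \<le> a \<Longrightarrow> a \<le> b \<Longrightarrow> b \<le> c \<Longrightarrow> c \<le> 1 \<Longrightarrow> D a c \<le> D a b + D b c"
    and pos: "\<And>a b. 0 \<le> a \<Longrightarrow> a < b \<Longrightarrow> b \<le> 1 \<Longrightarrow> 0 < D a b"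
  obtains f :: "real \<Rightarrow> real ^ 'n" where
    "\<And>x y. 0 \<le> x \<Longrightarrow> x < y \<Longrightarrow> y \<le> 1 \<Longrightarrow> D x y \<le> 72 * real m * norm (f x - f y)"
    "\<And>x y. 0 \<le> x \<Longrightarrow> x < y \<Longrightarrow> y \<le> 1 \<Longrightarrow> norm (f x - f y) \<le> 12 * real CARD('n) * real m * D x y"
proof -
  let ?M = "\<lambda>k. (4 * real m) ^ k"
  have M: "?M k > 0" for k using m by simp
  have T: "finite (T k)" "T k \<subseteq> {0..1}" "inj_on (v k) (T k)" for k
    using chain[of k] unfolding grid_chain_def by auto
  have cons: "grid_adj (v k a) (v k b)" "R / ?M k \<le> D a b" "D a b \<le> 3 * (R / ?M k)"
    if "consecutive (T k) a b" for k a b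
    using chain[of k] that unfolding grid_chain_def by auto
  define locates where "locates x A B F \<longleftrightarrow>
    (\<forall>k. consecutive (T k) (A k) (B k) \<and> A k \<le> x \<and> x \<le> B k \<and>
      (\<forall>c. (min (v k (A k) c) (v k (B k) c) - 1 / 3) / ?M k \<le> F c \<and>
        F c \<le> (max (v k (A k) c) (v k (B k) c) + 1 / 3) / ?M k))"
    for x :: real and A B :: "nat \<Rightarrow> real" and F :: "'n \<Rightarrow> real"
  have "\<exists>A B F. locates x A B F" if "x \<in> {0..1}" for x
    using limit_point_of_refinements[where T = T and v = v and x = x and a = 0 and b = 1, OF m T(1) ref]
      T0 that unfolding locates_def by auto
  then obtain A B F where *: "\<And>x. x \<in> {0..1} \<Longrightarrow> locates x (A x) (B x) (F x)"
    by metis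
  have AB: "consecutive (T k) (A x k) (B x k)" "A x k \<le> x \<and> x \<le> B x k"
    and F: "(min (v k (A x k) c) (v k (B x k) c) - 1 / 3) / ?M k \<le> F x c \<and>
      F x c \<le> (max (v k (A x k) c) (v k (B x k) c) + 1 / 3) / ?M k"
    if "x \<in> {0..1}" for x k c
    using *[OF that] unfolding locates_def by blast+
  have AB_in: "A x k \<in> T k" "B x k \<in> T k" "A x k < B x k" "0 \<le> A x k" "B x k \<le> 1"
    if "x \<in> {0..1}" for x k
    using AB(1)[OF that, of k] T(2)[of k] unfolding consecutive_def by auto
  \<comment> \<open>The lattice at generation 0 has unit edges; the factor \<open>R\<close> restores
    the scale of \<open>D\<close>.\<close>
  define f :: "real \<Rightarrow> real ^ 'n" where "f x = (\<chi> c. R * F x c)" for x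
  have f: "(f x - f y) $ c = R * (F x c - F y c)" for x y c
    by (simp add: f_def right_diff_distrib)
  have main: "D x y \<le> 72 * real m * norm (f x - f y) \<and>
      norm (f x - f y) \<le> 12 * real CARD('n) * real m * D x y"
    if xy: "0 \<le> x" "x < y" "y \<le> 1" for x y
  proof -
    have x: "x \<in> {0..1}" and y: "y \<in> {0..1}" using xy by auto
    define meet where "meet k \<longleftrightarrow> {A x k, B x k} \<inter> {A y k, B y k} \<noteq> {}" for k
    have meet_D: "D x y \<le> 6 * (R / ?M k)" if "meet k" for k
    proof -
      have r: "R / ?M k > 0" using R M by simp
      from AB(1)[OF x, of k] AB(1)[OF y, of k] show ?thesis
      proof (cases rule: consecutive_cases)
        case 1
        have "D x y \<le> D (A x k) (B x k)"
          using mono[of "A x k" x y "B x k"] AB(2)[OF x, of k] AB(2)[OF y, of k] AB_in[OF x, of k] xy 1 by simp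
        then show ?thesis using cons(3)[OF AB(1)[OF x, of k]] r by linarith
      next
        case 2
        then have "B x k = A y k"
          using that AB_in(3)[OF x, of k] AB_in(3)[OF y, of k] unfolding meet_def by auto
        then have "D x y \<le> D x (B x k) + D (A y k) y"
          using tri[of x "B x k" y] AB(2)[OF x, of k] AB(2)[OF y, of k] xy by simp
        also have "\<dots> \<le> D (A x k) (B x k) + D (A y k) (B y k)"
          using AB(2)[OF x, of k] AB(2)[OF y, of k] AB_in[OF x, of k] AB_in[OF y, of k]
          by (intro add_mono mono) auto
        finally show ?thesis
          using cons(3)[OF AB(1)[OF x, of k]] cons(3)[OF AB(1)[OF y, of k]] by linarith
      next
        case 3
        then show ?thesis using AB(2)[OF x, of k] AB(2)[OF y, of k] xy(2) by simp
      qed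
    qed
    \<comment> \<open>Meeting pieces keep \<open>D x y\<close> below \<open>6 * (R / ?M k)\<close>,
      which tends to 0, so meeting fails eventually. At generation 0 it holds, as there is only one
      piece.\<close>
    have "4 * real m > 1" using m by simp
    then obtain n where "6 * R / D x y < ?M n" using real_arch_pow by blast
    then have "6 * (R / ?M n) < D x y"
      using pos[OF xy] M[of n] by (simp add: field_simps)
    then have "\<not> meet n" using meet_D[of n] by linarith
    moreover have "meet 0"
    proof -
      have "A x 0 = 0" "A y 0 = 0"
        using AB_in[OF x, of 0] AB_in[OF y, of 0] T0 by auto
      then show ?thesis unfolding meet_def by simp
    qed
    ultimately obtain j where j: "meet j" "\<not> meet (Suc j)"
      using exists_least_lemma[of "\<lambda>k. \<not> meet k"] by blast
    let ?k = "Suc j"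
    have upper: "\<bar>F x c - F y c\<bar> \<le> 3 / ?M j" for c
    proof -
      let ?lx = "min (v j (A x j) c) (v j (B x j) c)" and ?hx = "max (v j (A x j) c) (v j (B x j) c)"
      let ?ly = "min (v j (A y j) c) (v j (B y j) c)" and ?hy = "max (v j (A y j) c) (v j (B y j) c)"
      obtain u where "u \<in> {A x j, B x j}" "u \<in> {A y j, B y j}" using j(1) meet_def by auto
      then have "?lx \<le> v j u c" "v j u c \<le> ?hx" "?ly \<le> v j u c" "v j u c \<le> ?hy" by auto
      moreover have "?hx \<le> ?lx + 1" "?hy \<le> ?ly + 1"
        using grid_adj_coord[OF cons(1)[OF AB(1)[OF x]]] grid_adj_coord[OF cons(1)[OF AB(1)[OF y]]]
        by simp_all
      ultimately show ?thesis
        using boxes_meet[of ?lx "v j u c" ?hx ?ly ?hy] F[OF x, of j c] F[OF y, of j c] M by blast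
    qed
    have ord: "B x ?k < A y ?k"
      using AB(1)[OF x, of ?k] AB(1)[OF y, of ?k]
    proof (cases rule: consecutive_cases)
      case 1
      then show ?thesis using j(2) meet_def by simp
    next
      case 2
      then show ?thesis using j(2) meet_def by (cases "B x ?k = A y ?k") auto
    next
      case 3
      then show ?thesis using AB(2)[OF x, of ?k] AB(2)[OF y, of ?k] xy(2) by simp
    qed
    \<comment> \<open>At generation \<open>j + 1\<close> at least one whole piece separates the
      pieces of \<open>x\<close> and \<open>y\<close>.\<close>
    have lower: "R / ?M ?k \<le> D x y"
    proof -
      obtain u w where uw: "consecutive (T ?k) u w" "B x ?k \<le> u" "w \<le> A y ?k"
        by (rule consecutive_exists[OF T(1) AB_in(2)[OF x] AB_in(1)[OF y] ord order_refl]) (use ord in auto)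
      then have "D u w \<le> D x y"
        using mono[of x u w y] AB(2)[OF x, of ?k] AB(2)[OF y, of ?k] xy
        unfolding consecutive_def by force
      then show ?thesis using cons(2)[OF uw(1)] by simp
    qed
    have "norm (f x - f y) \<le> (\<Sum>c\<in>UNIV. \<bar>(f x - f y) $ c\<bar>)" by (rule norm_le_l1_cart)
    also have "\<dots> \<le> (\<Sum>c\<in>(UNIV::'n set). R * (3 / ?M j))"
      unfolding f abs_mult using upper R by (intro sum_mono mult_mono) auto
    also have "\<dots> = 12 * real CARD('n) * real m * (R / ?M ?k)"
      using m by (simp add: field_simps)
    also have "\<dots> \<le> 12 * real CARD('n) * real m * D x y"
      using lower by (intro mult_left_mono) auto
    finally have up: "norm (f x - f y) \<le> 12 * real CARD('n) * real m * D x y" .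
    have "{v ?k (A x ?k), v ?k (B x ?k)} \<inter> {v ?k (A y ?k), v ?k (B y ?k)} = {}"
    proof -
      have "v ?k ` {A x ?k, B x ?k} \<inter> v ?k ` {A y ?k, B y ?k} = v ?k ` ({A x ?k, B x ?k} \<inter> {A y ?k, B y ?k})"
        by (rule inj_on_image_Int[OF T(3), symmetric]) (simp_all add: AB_in[OF x] AB_in[OF y])
      then show ?thesis using j(2) unfolding meet_def by simp
    qed
    from grid_edges_separated[OF cons(1)[OF AB(1)[OF x]] cons(1)[OF AB(1)[OF y]] this]
    obtain c where c: "max (v ?k (A x ?k) c) (v ?k (B x ?k) c) + 1 \<le> min (v ?k (A y ?k) c) (v ?k (B y ?k) c) \<or>
      max (v ?k (A y ?k) c) (v ?k (B y ?k) c) + 1 \<le> min (v ?k (A x ?k) c) (v ?k (B x ?k) c)" by blast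
    from c have "1 / 3 / ?M ?k \<le> \<bar>F x c - F y c\<bar>"
    proof
      assume "max (v ?k (A x ?k) c) (v ?k (B x ?k) c) + 1 \<le> min (v ?k (A y ?k) c) (v ?k (B y ?k) c)"
      from boxes_apart[OF this M F[OF x] F[OF y]] show ?thesis .
    next
      assume "max (v ?k (A y ?k) c) (v ?k (B y ?k) c) + 1 \<le> min (v ?k (A x ?k) c) (v ?k (B x ?k) c)"
      from boxes_apart[OF this M F[OF y] F[OF x]] show ?thesis by (simp only: abs_minus_commute)
    qed
    then have "R * (1 / 3 / ?M ?k) \<le> R * \<bar>F x c - F y c\<bar>" using R by (intro mult_left_mono) auto
    also have "\<dots> = \<bar>(f x - f y) $ c\<bar>" unfolding f abs_mult using R by simp
    also have "\<dots> \<le> norm (f x - f y)" by (rule component_le_norm_cart)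
    finally have "R * (1 / 3 / ?M ?k) \<le> norm (f x - f y)" .
    \<comment> \<open>The constant is the product of 6 from \<open>meet_D\<close>, 3 from the gap
      1/3 between the boxes, and \<open>4 * m\<close> from the change of generation.\<close>
    then have "72 * real m * (R * (1 / 3 / ?M ?k)) \<le> 72 * real m * norm (f x - f y)"
      by (intro mult_left_mono) auto
    moreover have "72 * real m * (R * (1 / 3 / ?M ?k)) = 6 * (R / ?M j)" using m by simp
    ultimately have "D x y \<le> 72 * real m * norm (f x - f y)" using meet_D[OF j(1)] by linarith
    with up show ?thesis by blast
  qed
  then show ?thesis using that[of f] by blast
qed

section \<open>Arcs of bounded turning\<close>

context Metric_space
begin

lemma dist_le_mdiameter:
  assumes "mbounded S" "x \<in> S" "y \<in> S"
  shows "d x y \<le> mdiameter S"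
proof -
  obtain B where "\<forall>x\<in>S. \<forall>y\<in>S. d x y \<le> B" using assms(1) mbounded_alt by blast
  then have "bdd_above ((\<lambda>(x, y). d x y) ` (S \<times> S))" by (intro bdd_aboveI[of _ B]) auto
  from cSUP_upper[OF _ this, of "(x, y)"] show ?thesis
    using assms(2,3) unfolding mdiameter_def by auto
qed

lemma mdiameter_le:
  assumes "S \<noteq> {}" "\<And>x y. x \<in> S \<Longrightarrow> y \<in> S \<Longrightarrow> d x y \<le> B"
  shows "mdiameter S \<le> B"
  using assms unfolding mdiameter_def by (auto intro!: cSUP_least)

end

locale turning_arc = Metric_space "{0..1::real}" d for d :: "real \<Rightarrow> real \<Rightarrow> real" +
  fixes c :: real
  assumes topology: "mtopology = top_of_set {0..1}" and turning: "bounded_turning c" and c: "c \<ge> 1"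
begin

text \<open>In contrast to \<open>d\<close>, the diameter of the subarc is monotone under inclusion;
  bounded turning makes the two comparable.\<close>

definition width :: "real \<Rightarrow> real \<Rightarrow> real"
  where "width a b = mdiameter {a..b}"

text \<open>The unit interval is compact in the standard topology, which \<open>d\<close> induces.
  Boundedness is what makes \<open>mdiameter\<close> the true diameter.\<close>

lemma mbounded_Icc: "0 \<le> a \<Longrightarrow> b \<le> 1 \<Longrightarrow> mbounded {a..b}"
proof -
  assume "0 \<le> a" "b \<le> 1"
  moreover have "compactin mtopology {0..1}"
    unfolding topology by (simp add: compactin_subtopology)
  ultimately show ?thesis using compactin_imp_mbounded mbounded_subset by (metis atLeastatMost_subset_iff)
qed

lemma dist_le_width: "0 \<le> a \<Longrightarrow> a \<le> b \<Longrightarrow> b \<le> 1 \<Longrightarrow> d a b \<le> width a b"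
  unfolding width_def by (intro dist_le_mdiameter mbounded_Icc) auto

(* The continuum joining a and b contains {a..b}, because connected subsets of the line are intervals. *)
lemma width_le:
  assumes "0 \<le> a" "a \<le> b" "b \<le> 1"
  shows "width a b \<le> c * d a b"
proof -
  obtain K where K: "compactin mtopology K" "connectedin mtopology K" "a \<in> K" "b \<in> K"
    "mdiameter K \<le> c * d a b"
    using turning[unfolded bounded_turning_def, rule_format, of a b] assms by auto
  have "connected K" using K(2) unfolding topology by (simp add: connectedin_subtopology)
  then have "{a..b} \<subseteq> K" using K(3,4) connected_contains_Icc by blast
  then have "width a b \<le> mdiameter K"
    unfolding width_def using assms K(1)
    by (intro mdiameter_le dist_le_mdiameter compactin_imp_mbounded) auto
  then show ?thesis using K(5) by simp
qed

lemma width_mono: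
  "0 \<le> a \<Longrightarrow> a \<le> a' \<Longrightarrow> a' \<le> b' \<Longrightarrow> b' \<le> b \<Longrightarrow> b \<le> 1 \<Longrightarrow> width a' b' \<le> width a b"
  unfolding width_def by (intro mdiameter_le dist_le_mdiameter mbounded_Icc) auto

lemma width_nonneg: "0 \<le> a \<Longrightarrow> a \<le> b \<Longrightarrow> b \<le> 1 \<Longrightarrow> 0 \<le> width a b"
  using dist_le_width nonneg order_trans by blast

lemma width_refl: "0 \<le> a \<Longrightarrow> a \<le> 1 \<Longrightarrow> width a a = 0"
  by (simp add: width_def mdiameter_def)

lemma width_pos:
  assumes "0 \<le> a" "a < b" "b \<le> 1"
  shows "0 < width a b"
proof -
  have "0 < d a b" using assms by (intro mdist_pos_less) auto
  also have "\<dots> \<le> width a b" using assms by (intro dist_le_width) auto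
  finally show ?thesis .
qed

text \<open>Two points on the same side of \<open>y\<close> are covered by monotonicity; for points
  on different sides the triangle inequality passes through \<open>y\<close>.\<close>

lemma width_triangle:
  assumes "0 \<le> x" "x \<le> y" "y \<le> z" "z \<le> 1"
  shows "width x z \<le> width x y + width y z"
  unfolding width_def[of x z]
proof (rule mdiameter_le)
  show "{x..z} \<noteq> {}" using assms by simp
  have le: "d u w \<le> width x y + width y z" if "u \<in> {x..z}" "w \<in> {x..z}" "u \<le> w" for u w
  proof -
    have pos: "0 \<le> width x y" "0 \<le> width y z" using width_nonneg assms by auto
    have duw: "d u w \<le> width u w" using that assms by (intro dist_le_width) auto
    consider "w \<le> y" | "u \<le> y" "y \<le> w" | "y \<le> u" by linarith
    then show ?thesis
    proof cases
      case 1
      then have "width u w \<le> width x y" using that assms by (intro width_mono) auto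
      then show ?thesis using duw pos by linarith
    next
      case 2
      have "d u w \<le> d u y + d y w" using that assms by (intro triangle) auto
      also have "\<dots> \<le> width x y + width y z"
        unfolding width_def using that 2 assms
        by (intro add_mono dist_le_mdiameter mbounded_Icc) auto
      finally show ?thesis .
    next
      case 3
      then have "width u w \<le> width y z" using that assms by (intro width_mono) auto
      then show ?thesis using duw pos by linarith
    qed
  qed
  show "d u w \<le> width x y + width y z" if "u \<in> {x..z}" "w \<in> {x..z}" for u w
    using le[of u w] le[of w u] that commute[of u w] by (cases "u \<le> w") auto
qed

text \<open>By subadditivity and bounded turning the width is Lipschitz with constant
  \<open>c\<close> for the metric \<open>d\<close>, and \<open>d\<close> induces the standard
  topology.\<close>

lemma continuous_on_width:
  assumes "0 \<le> a" "b \<le> 1"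
  shows "continuous_on {a..b} (width a)"
  unfolding continuous_on_iff
proof (intro ballI allI impI)
  fix t e :: real assume t: "t \<in> {a..b}" and e: "0 < e"
  have "openin (top_of_set {0..1}) (mball t (e / c))"
    using openin_mball[of t "e / c"] unfolding topology .
  moreover have "t \<in> mball t (e / c)" using t assms e c by simp
  ultimately obtain \<delta> where \<delta>: "\<delta> > 0" "\<And>s. s \<in> {0..1} \<Longrightarrow> dist s t < \<delta> \<Longrightarrow> s \<in> mball t (e / c)"
    unfolding openin_euclidean_subtopology_iff by metis
  have "dist (width a s) (width a t) < e" if s: "s \<in> {a..b}" "dist s t < \<delta>" for s
  proof -
    have "d t s < e / c" using \<delta>(2)[of s] s assms by auto
    then have *: "c * d t s < e" using c by (simp add: field_simps)
    have "\<bar>width a x - width a y\<bar> \<le> c * d x y" if "a \<le> x" "x \<le> y" "y \<le> b" for x y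
      using width_triangle[of a x y] width_mono[of a a x y] width_le[of x y] that assms by simp
    from this[of s t] this[of t s] show ?thesis
      using * s(1) t commute[of s t] by (cases "s \<le> t") (auto simp: dist_real_def abs_minus_commute)
  qed
  then show "\<exists>\<delta>>0. \<forall>s\<in>{a..b}. dist s t < \<delta> \<longrightarrow> dist (width a s) (width a t) < e"
    using \<delta>(1) by blast
qed

section \<open>Cutting a subarc into pieces of comparable diameter\<close>

lemma width_cut:
  assumes "0 \<le> a" "a \<le> b" "b \<le> 1" "0 \<le> r" "r \<le> width a b"
  obtains t where "a \<le> t" "t \<le> b" "width a t = r"
  using IVT'[of "width a" a r b] continuous_on_width[of a b] assms width_refl[of a] by auto

text \<open>The pieces have width exactly \<open>r\<close>; a remainder between \<open>t N\<close>
  and \<open>b\<close> is left open.\<close>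

definition cuts :: "real \<Rightarrow> real \<Rightarrow> real \<Rightarrow> nat \<Rightarrow> (nat \<Rightarrow> real) \<Rightarrow> bool"
  where "cuts a b r N t \<longleftrightarrow> t 0 = a \<and> t N \<le> b \<and>
    (\<forall>k<N. t k \<le> t (Suc k) \<and> width (t k) (t (Suc k)) = r)"

lemma cuts_mono:
  assumes "cuts a b r N t" "j \<le> k" "k \<le> N"
  shows "t j \<le> t k"
  using assms(2,3)
proof (induction k)
  case (Suc k)
  show ?case
  proof (cases "j = Suc k")
    case False
    then have "t j \<le> t k" using Suc by simp
    also have "\<dots> \<le> t (Suc k)" using assms(1) Suc.prems unfolding cuts_def by simp
    finally show ?thesis .
  qed simp
qed simp

lemma cuts_bounds:
  assumes "cuts a b r N t" "k \<le> N"
  shows "a \<le> t k" "t k \<le> b"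
  using cuts_mono[OF assms(1), of 0 k] cuts_mono[OF assms(1), of k N] assms unfolding cuts_def by auto

lemma cuts_width_ge:
  assumes cuts: "cuts a b r N t" and jk: "j < k" "k \<le> N" and ab: "0 \<le> a" "b \<le> 1"
  shows "r \<le> width (t j) (t k)"
proof -
  have "r = width (t j) (t (Suc j))" using cuts jk unfolding cuts_def by simp
  also have "\<dots> \<le> width (t j) (t k)"
    using cuts_bounds[OF cuts, of j] cuts_bounds[OF cuts, of k] cuts_mono[OF cuts, of j "Suc j"]
      cuts_mono[OF cuts, of "Suc j" k] jk ab by (intro width_mono) auto
  finally show ?thesis .
qed

text \<open>Distinct cut points have distance at least \<open>r / c\<close>, by bounded turning. A
  covering by sets of smaller diameter thus has at least as many members as there are cut
  points.\<close>

lemma cuts_count: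
  assumes hom: "homogeneous C s" and ab: "0 \<le> a" "a \<le> b" "b \<le> 1"
    and r: "r > 0" "width a b \<le> K * r" "K \<ge> 1" and cuts: "cuts a b r N t"
  shows "real N \<le> C * (2 * c * K) powr s"
proof -
  \<comment> \<open>With this value the covering sets have diameter at most
    \<open>r / (2 * c)\<close>; the factor 2 makes the comparison with \<open>r / c\<close>
    strict.\<close>
  define \<epsilon> where "\<epsilon> = inverse (2 * c * K)"
  have cK: "2 * c * K > 1" using c r(3) mult_mono[of 1 c 1 K] by simp
  then have \<epsilon>: "\<epsilon> \<in> {0<..<1}" unfolding \<epsilon>_def
    by (auto simp only: greaterThanLessThan_iff inverse_positive_iff_positive inverse_less_1_iff)
  obtain \<U> where U: "finite \<U>" "real (card \<U>) \<le> C * \<epsilon> powr (- s)" "{a..b} \<subseteq> \<Union>\<U>"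
    "\<And>U. U \<in> \<U> \<Longrightarrow> mbounded U \<and> mdiameter U \<le> \<epsilon> * mdiameter {a..b}"
    using hom \<epsilon> mbounded_Icc[OF ab(1,3)] unfolding homogeneous_def by metis
  have "\<exists>U\<in>\<U>. t k \<in> U" if "k \<le> N" for k
    using U(3) cuts_bounds[OF cuts that] by auto
  then obtain g where g: "\<And>k. k \<le> N \<Longrightarrow> g k \<in> \<U> \<and> t k \<in> g k" by metis
  have small: "\<epsilon> * mdiameter {a..b} < r / c"
  proof -
    have "\<epsilon> * mdiameter {a..b} \<le> \<epsilon> * (K * r)"
      using r(2) \<epsilon> unfolding width_def by (intro mult_left_mono) auto
    also have "\<dots> = r / (2 * c)" using c r by (simp add: \<epsilon>_def field_simps)
    also have "\<dots> < r / c" using c r by (simp add: field_simps)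
    finally show ?thesis .
  qed
  have ne: "g j \<noteq> g k" if jk: "j < k" "k \<le> N" for j k
  proof
    assume eq: "g j = g k"
    have "r \<le> width (t j) (t k)" by (rule cuts_width_ge[OF cuts jk ab(1,3)])
    also have "\<dots> \<le> c * d (t j) (t k)"
      using cuts_bounds[OF cuts, of j] cuts_bounds[OF cuts, of k] cuts_mono[OF cuts, of j k] jk ab
      by (intro width_le) auto
    finally have "r / c \<le> d (t j) (t k)" using c by (simp add: field_simps)
    also have "\<dots> \<le> mdiameter (g j)"
      using U(4) g[of j] g[of k] jk eq by (intro dist_le_mdiameter) auto
    finally show False using U(4)[of "g j"] g[of j] jk small by auto
  qed
  have "inj_on g {..N}"
    by (rule inj_onI) (metis atMost_iff linorder_neqE_nat ne)
  then have "card {..N} \<le> card \<U>" using g U(1) by (intro card_inj_on_le[of g]) auto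
  then have "real N \<le> C * \<epsilon> powr (- s)" using U(2) by simp
  also have "\<epsilon> powr (- s) = (2 * c * K) powr s"
    unfolding \<epsilon>_def using cK by (simp only: powr_minus inverse_powr inverse_inverse_eq)
  finally show ?thesis .
qed

text \<open>Homogeneity bounds the number of cuts, so a longest sequence exists. If its remainder
  had width at least \<open>r\<close>, continuity would allow one more cut.\<close>

lemma maximal_cuts:
  assumes hom: "homogeneous C s" and ab: "0 \<le> a" "a \<le> b" "b \<le> 1"
    and r: "r > 0" "width a b \<le> K * r" "K \<ge> 1"
  obtains N t where "cuts a b r N t" "width (t N) b < r"
proof -
  let ?P = "\<lambda>N. \<exists>t. cuts a b r N t"
  have "?P 0" unfolding cuts_def by (rule exI[of _ "\<lambda>_. a"]) (use ab in auto)
  moreover have "N \<le> nat \<lceil>C * (2 * c * K) powr s\<rceil>" if "?P N" for N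
  proof -
    have "real N \<le> C * (2 * c * K) powr s" using cuts_count[OF hom ab r] that by blast
    then show ?thesis by linarith
  qed
  ultimately obtain N where N: "?P N" "\<And>n. ?P n \<Longrightarrow> n \<le> N"
    using ex_has_greatest_nat[of ?P 0 "\<lambda>n. n"] by (metis le_imp_less_Suc)
  then obtain t where t: "cuts a b r N t" by blast
  have tN: "a \<le> t N" "t N \<le> b" using cuts_bounds[OF t] by auto
  have "width (t N) b < r"
  proof (rule ccontr)
    assume "\<not> width (t N) b < r"
    then obtain u where u: "t N \<le> u" "u \<le> b" "width (t N) u = r"
      using width_cut[of "t N" b r] tN ab r(1) by auto
    have "cuts a b r (Suc N) (t(Suc N := u))"
      using t u unfolding cuts_def by (auto simp: less_Suc_eq)
    then show False using N(2) by force
  qed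
  then show ?thesis using t that by blast
qed

(* A path along a grid edge scaled by 4m has even length, so an odd number of pieces is made even
   by merging; the leftover shorter than r is merged as well, whence the factor 3. *)
lemma even_subdivision:
  assumes hom: "homogeneous C s" and ab: "0 \<le> a" "a < b" "b \<le> 1" and m: "m > 0"
    and r: "r > 0" "4 * real m * r \<le> width a b" "width a b \<le> 12 * real m * r"
  obtains N t where "even N" "4 * m \<le> N" "real N \<le> C * (24 * c * real m) powr s"
    "t 0 = a" "t N = b" "\<And>k. k < N \<Longrightarrow> t k < t (Suc k)"
    "\<And>k. k < N \<Longrightarrow> r \<le> width (t k) (t (Suc k)) \<and> width (t k) (t (Suc k)) \<le> 3 * r"
proof -
  have ab': "a \<le> b" and K: "12 * real m \<ge> 1" using ab m by auto
  obtain N t where t: "cuts a b r N t" "width (t N) b < r"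
    using maximal_cuts[OF hom ab(1) ab' ab(3) r(1,3) K] by blast
  have count: "real N \<le> C * (24 * c * real m) powr s"
    using cuts_count[OF hom ab(1) ab' ab(3) r(1,3) K t(1)] by (simp add: mult_ac)
  note bounds = cuts_bounds[OF t(1)]
  have tk: "t k \<le> t (Suc k)" "width (t k) (t (Suc k)) = r" if "k < N" for k
    using t(1) that unfolding cuts_def by auto
  have less: "t k < t (Suc k)" if "k < N" for k
    using tk[OF that] width_refl[of "t k"] bounds[of k] ab r(1) that
    by (cases "t k = t (Suc k)") auto
  have sum: "width a (t k) \<le> real k * r" if "k \<le> N" for k
    using that
  proof (induction k)
    case 0
    then show ?case using t(1) width_refl[of a] ab unfolding cuts_def by simp
  next
    case (Suc k)
    then have "width a (t (Suc k)) \<le> width a (t k) + width (t k) (t (Suc k))"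
      using bounds[of k] bounds[of "Suc k"] tk ab by (intro width_triangle) auto
    also have "\<dots> \<le> real (Suc k) * r" using Suc tk[of k] by (simp add: algebra_simps)
    finally show ?case .
  qed
  have "width a b \<le> width a (t N) + width (t N) b"
    using bounds[of N] ab by (intro width_triangle) auto
  then have "4 * real m * r < (real N + 1) * r"
    using sum[of N] t(2) r(2) by (simp add: algebra_simps)
  then have "4 * real m < real N + 1" using r(1) by simp
  then have N: "4 * m \<le> N" by linarith
  define n where "n = (if even N then N else N - 1)"
  \<comment> \<open>The bound \<open>4 * m\<close> is even, so an odd \<open>N\<close> exceeds it
    and may be lowered by one.\<close>
  have "N \<noteq> 4 * m" if "odd N" using that by auto
  then have n: "even n" "4 * m \<le> n" "n \<le> N" "N \<le> Suc n" using N by (auto simp: n_def)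
  define p where "p = n - 1"
  have p: "n = Suc p" "p < N" using n m by (auto simp: p_def)
  \<comment> \<open>The last piece of the new subdivision runs from \<open>t p\<close> to
    \<open>b\<close>, swallowing everything after the cut of index \<open>p\<close>.\<close>
  define u where "u k = (if k < n then t k else b)" for k
  have last: "r \<le> width (t p) b" "width (t p) b \<le> 3 * r" "t p < b"
  proof -
    have tp: "a \<le> t p" "t p < t n" "t n \<le> b" "width (t p) (t n) = r"
      using bounds[of p] bounds[of n] tk[of p] less[of p] p n by auto
    then show "t p < b" by simp
    show "r \<le> width (t p) b" using width_mono[of "t p" "t p" "t n" b] tp ab by simp
    have "width (t n) (t N) \<le> r"
      using n tk[of n] width_refl[of "t N"] bounds[of N] ab r(1) by (cases "n = N") (auto simp: le_Suc_eq)
    moreover have "t n \<le> t N" using cuts_mono[OF t(1), of n N] n by simp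
    ultimately have "width (t n) b \<le> r + width (t N) b"
      using width_triangle[of "t n" "t N" b] bounds[of n] bounds[of N] n ab by simp
    then show "width (t p) b \<le> 3 * r"
      using width_triangle[of "t p" "t n" b] tp t(2) ab by simp
  qed
  show ?thesis
  proof (rule that[of n u])
    show "even n" "4 * m \<le> n" by fact+
    show "real n \<le> C * (24 * c * real m) powr s" using count n(3) by linarith
    show "u 0 = a" "u n = b" using t(1) p by (auto simp: u_def cuts_def)
    fix k assume "k < n"
    then consider "Suc k < n" | "k = p" using p by linarith
    then show "u k < u (Suc k)"
      "r \<le> width (u k) (u (Suc k)) \<and> width (u k) (u (Suc k)) \<le> 3 * r"
      using less[of k] tk[of k] last p n(3) r(1) by (cases; simp add: u_def)+
  qed
qed

section \<open>One refinement step and the embedding of a given arc\<close>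

text \<open>Homogeneity limits the number of new subarcs, and \<open>large\<close> says that this
  number does not exceed the length available to a lattice path in the cell. A path with exactly one
  edge for each subarc therefore exists.\<close>

lemma piece_refinement:
  fixes v :: "real \<Rightarrow> 'n::finite \<Rightarrow> int"
  assumes hom: "homogeneous C s" and m: "m > 0"
    and large: "C * (24 * c * real m) powr s \<le> 2 * real m ^ CARD('n)"
    and r: "r > 0" and chain: "grid_chain width (4 * real m * r) 0 1 T v" and ab: "consecutive T a b"
  shows "\<exists>S w. grid_chain width r a b S w \<and> w a = grid_scale m (v a) \<and>
    w b = grid_scale m (v b) \<and> w ` S \<subseteq> edge_cell m (v a) (v b)"
proof -
  have ab01: "0 \<le> a" "a < b" "b \<le> 1"
    using ab chain unfolding grid_chain_def consecutive_def by auto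
  have adj: "grid_adj (v a) (v b)" and width: "4 * real m * r \<le> width a b" "width a b \<le> 12 * real m * r"
    using ab chain unfolding grid_chain_def by (auto simp: mult.assoc)
  obtain N t where N: "even N" "4 * m \<le> N" "real N \<le> C * (24 * c * real m) powr s"
    and t: "t 0 = a" "t N = b" "\<And>k. k < N \<Longrightarrow> t k < t (Suc k)"
    "\<And>k. k < N \<Longrightarrow> r \<le> width (t k) (t (Suc k)) \<and> width (t k) (t (Suc k)) \<le> 3 * r"
    using even_subdivision[OF hom ab01 m r width] by metis
  have "real N \<le> real (2 * m ^ CARD('n))" using N(3) large by simp
  then have "N \<le> 2 * m ^ CARD('n)" by (simp only: of_nat_le_iff)
  from grid_chain_of_path[where D = width and r = r and t = t and N = N, OF t(3,1,2,4) edge_grid_path[OF adj m N(1,2) this]]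
  show ?thesis .
qed

lemma bilipschitz_embedding_exists:
  assumes hom: "homogeneous C s" and m: "m > 0"
    and large: "C * (24 * c * real m) powr s \<le> 2 * real m ^ CARD('n::finite)"
  shows "\<exists>f :: real \<Rightarrow> real ^ 'n.
    bilipschitz_embedding (72 * real m + 12 * real CARD('n) * real m * c) f"
proof -
  define R where "R = width 0 1"
  have R: "R > 0" unfolding R_def by (rule width_pos) auto
  let ?r = "\<lambda>k. R / (4 * real m) ^ k"
  \<comment> \<open>The clause for \<open>k = 0\<close> records that the construction starts from a
    single piece, from which the limit argument begins.\<close>
  let ?P = "\<lambda>k (T, v :: real \<Rightarrow> 'n \<Rightarrow> int). grid_chain width (?r k) 0 1 T v \<and> (k = 0 \<longrightarrow> T = {0, 1})"
  let ?Q = "\<lambda>k (T, v :: real \<Rightarrow> 'n \<Rightarrow> int) (T', v'). grid_refines m T v T' v'"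
  have "\<exists>F. \<forall>k. ?P k (F k) \<and> ?Q k (F k) (F (Suc k))"
  proof (rule dependent_nat_choice)
    \<comment> \<open>The whole arc is first represented by one lattice edge, from the origin in an
      arbitrary direction \<open>i\<close>.\<close>
    obtain i :: 'n where True by simp
    define v where "v x = ((\<lambda>_. 0)(i := (if x = 0 then 0 else 1 :: int)))" for x :: real
    have "grid_adj (v 0) (v 1)"
      using grid_adj_step[of "\<lambda>_. 0" i 0] by (simp add: v_def)
    moreover have "inj_on v {0, 1}" by (auto simp: v_def inj_on_def fun_eq_iff)
    moreover have "x = 0 \<and> y = 1" if "consecutive {0, 1} x y" for x y
      using that unfolding consecutive_def by auto
    ultimately have "grid_chain width R 0 1 {0, 1} v"
      using R unfolding grid_chain_def R_def by fastforce
    then have "?P 0 ({0, 1}, v)" by simp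
    then show "\<exists>p. ?P 0 p" by blast
  next
    fix p k assume p: "?P k p"
    obtain T v where Tv: "p = (T, v)" by fastforce
    have r: "?r (Suc k) > 0" "4 * real m * ?r (Suc k) = ?r k" using R m by auto
    have chain: "grid_chain width (4 * real m * ?r (Suc k)) 0 1 T v"
      using p unfolding Tv r(2) by simp
    obtain T' v' where "grid_chain width (?r (Suc k)) 0 1 T' v'" "grid_refines m T v T' v'"
      using grid_chain_refine[OF chain _ m piece_refinement[OF hom m large r(1) chain]] by auto
    then show "\<exists>p'. ?P (Suc k) p' \<and> ?Q k p p'"
      by (intro exI[of _ "(T', v')"]) (simp add: Tv)
  qed
  then obtain F where F: "\<forall>k. ?P k (F k) \<and> ?Q k (F k) (F (Suc k))" ..
  have chain: "grid_chain width (?r k) 0 1 (fst (F k)) (snd (F k))" for k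
    using F[rule_format, of k] by (simp only: case_prod_unfold)
  have ref: "grid_refines m (fst (F k)) (snd (F k)) (fst (F (Suc k))) (snd (F (Suc k)))" for k
    using F[rule_format, of k] by (simp only: case_prod_unfold)
  have T0: "fst (F 0) = {0, 1}" using F[rule_format, of 0] by (simp only: case_prod_unfold simp_thms)
  obtain f :: "real \<Rightarrow> real ^ 'n" where
    f: "\<And>x y. 0 \<le> x \<Longrightarrow> x < y \<Longrightarrow> y \<le> 1 \<Longrightarrow> width x y \<le> 72 * real m * norm (f x - f y)"
    "\<And>x y. 0 \<le> x \<Longrightarrow> x < y \<Longrightarrow> y \<le> 1 \<Longrightarrow> norm (f x - f y) \<le> 12 * real CARD('n) * real m * width x y"
    using embedding_of_refinements[where T = "\<lambda>k. fst (F k)" and v = "\<lambda>k. snd (F k)", OF m R chain ref T0 width_mono width_triangle width_pos] by blast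
  \<comment> \<open>The sum dominates the constants of both inequalities; the factor
    \<open>c\<close> enters when \<open>width\<close> is replaced by \<open>d\<close> in the upper
    one.\<close>
  define L where "L = 72 * real m + 12 * real CARD('n) * real m * c"
  have L: "L > 0" using m c unfolding L_def by (intro add_pos_nonneg) auto
  have less: "inverse L * d x y \<le> norm (f x - f y) \<and> norm (f x - f y) \<le> L * d x y"
    if xy: "0 \<le> x" "x < y" "y \<le> 1" for x y
  proof
    have "d x y \<le> 72 * real m * norm (f x - f y)"
      using dist_le_width[of x y] f(1)[OF xy] xy by simp
    also have "\<dots> \<le> L * norm (f x - f y)"
      unfolding L_def using c by (intro mult_right_mono) auto
    finally show "inverse L * d x y \<le> norm (f x - f y)"
      using L by (simp add: field_simps)
    have "norm (f x - f y) \<le> 12 * real CARD('n) * real m * (c * d x y)"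
      using f(2)[OF xy] width_le[of x y] xy
      by (smt (verit) mult_left_mono of_nat_0_le_iff mult_nonneg_nonneg)
    also have "\<dots> \<le> L * d x y"
      unfolding L_def by (simp add: algebra_simps)
    finally show "norm (f x - f y) \<le> L * d x y" .
  qed
  have "bilipschitz_embedding L f"
    unfolding bilipschitz_embedding_def
  proof (intro ballI)
    fix x y :: real assume "x \<in> {0..1}" "y \<in> {0..1}"
    then show "inverse L * d x y \<le> norm (f x - f y) \<and> norm (f x - f y) \<le> L * d x y"
      using less[of x y] less[of y x] commute[of x y] norm_minus_commute[of "f x" "f y"]
      by (cases x y rule: linorder_cases) auto
  qed
  then show ?thesis unfolding L_def by blast
qed

end

section \<open>Choice of the scale and uniformity of the constant\<close>

lemma exists_large_scale:
  fixes s A B :: real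
  assumes "A > 0" "B > 0" "s < real n"
  obtains m :: nat where "m > 0" "A * (B * real m) powr s \<le> real m ^ n"
proof -
  define E where "E = A * B powr s"
  \<comment> \<open>Dividing by \<open>m powr s\<close>, the requirement becomes \<open>E\<close>
    \<le> \<open>m powr (n - s)\<close>, which a large \<open>m\<close> meets because the exponent
    is positive.\<close>
  define m where "m = Suc (nat \<lceil>E powr (1 / (real n - s))\<rceil>)"
  have E: "E > 0" using assms by (simp add: E_def)
  have m: "m > 0" by (simp add: m_def)
  have "E = (E powr (1 / (real n - s))) powr (real n - s)"
    using E assms(3) by (simp add: powr_powr)
  also have "\<dots> \<le> real m powr (real n - s)"
    using assms(3) unfolding m_def by (intro powr_mono2) (auto, linarith)
  finally have "E * real m powr s \<le> real m powr (real n - s) * real m powr s"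
    by (intro mult_right_mono) auto
  also have "\<dots> = real m powr real n"
    by (simp flip: powr_add)
  also have "\<dots> = real m ^ n"
    using m by (simp add: powr_realpow)
  finally have "A * (B * real m) powr s \<le> real m ^ n"
    using assms by (simp add: E_def powr_mult mult_ac)
  then show ?thesis using that m by blast
qed

theorem proposition8p2:
  fixes s C c :: real
  assumes "s \<ge> 1" and "C > 0" and "c \<ge> 1"
    and "CARD('n::finite) = nat \<lfloor>s\<rfloor> + 1"
  shows "\<exists>L>1. \<forall>d :: real \<Rightarrow> real \<Rightarrow> real.
           Metric_space {0..1} d \<longrightarrow>
           Metric_space.mtopology {0..1} d = top_of_set {0..1} \<longrightarrow>
           Metric_space.bounded_turning {0..1} d c \<longrightarrow>
           Metric_space.homogeneous {0..1} d C s \<longrightarrow>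
           (\<exists>f :: real \<Rightarrow> real ^ 'n. Metric_space.bilipschitz_embedding {0..1} d L f)"
proof -
  \<comment> \<open>The dimension exceeds \<open>s\<close> strictly, which is what the choice of
    \<open>m\<close> requires. This choice depends on \<open>C\<close>, \<open>c\<close>,
    \<open>s\<close> and the dimension but not on the metric, so \<open>L\<close> is
    uniform.\<close>
  have "s < real CARD('n)" unfolding assms(4) using assms(1) by linarith
  then obtain m where m: "m > 0" "C * (24 * c * real m) powr s \<le> real m ^ CARD('n)"
    using exists_large_scale[of C "24 * c" s "CARD('n)"] assms by auto
  define L where "L = 72 * real m + 12 * real CARD('n) * real m * c"
  have "72 * real m \<le> L" unfolding L_def using assms(3) by simp
  moreover have "1 < 72 * real m" using m(1) by simp
  ultimately have "L > 1" by linarith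
  moreover have "\<exists>f :: real \<Rightarrow> real ^ 'n. Metric_space.bilipschitz_embedding {0..1} d L f"
    if "Metric_space {0..1} d" "Metric_space.mtopology {0..1} d = top_of_set {0..1}"
      "Metric_space.bounded_turning {0..1} d c" "Metric_space.homogeneous {0..1} d C s"
    for d :: "real \<Rightarrow> real \<Rightarrow> real"
  proof -
    interpret turning_arc d c
      using that(1-3) assms(3) by (simp add: turning_arc_def turning_arc_axioms_def)
    have "0 \<le> real m ^ CARD('n)" by simp
    with m(2) have "C * (24 * c * real m) powr s \<le> 2 * real m ^ CARD('n)" by linarith
    from bilipschitz_embedding_exists[OF that(4) m(1) this] show ?thesis unfolding L_def .
  qed
  ultimately show ?thesis by blast
qed

end
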